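(* Let $X$ be a separable infinite-dimensional $F$-space over $\mathbb{K}\in\{\mathbb{R},\mathbb{C}\}$ and let $T$ be a quasi-rigid continuous linear operator on $X$. If $N$ is a maximal collection (of operators in $\mathcal{L}(X)$) simultaneously approximated by $T$ that contains the identity operator, then $$\mathcal{G}(T)=N\cap\mathrm{GL}(X)\quad\text{and}\quad\mathrm{conv}_{\mathbb{K}}(\mathcal{G}(T))\subset N.$$ Moreover, if $X$ is a Banach space, then $\mathcal{G}(T)$ is locally convex, and the affine manifold $\mathrm{conv}_{\mathbb{K}}(\mathcal{G}(T))$ is the unique maximal collection simultaneously approximated by $T$ that contains the identity operator.
   Context: An $F$-space is a completely metrizable topological vector space. $\mathcal{L}(X)$ is the space of continuous linear operators on $X$ and $\mathrm{GL}(X)$ the group of invertible elements of $\mathcal{L}(X)$. Maximality of collections is with respect to inclusion. For a continuous linear operator $S$ on an $F$-space $Y$, $\Sigma(S)$ is the set of $h\in\mathcal{L}(Y)$ such that the set of $y\in Y$ for which there is a strictly increasing sequence of positive integers $(\omega_n)_n$ with $S^{\omega_n}y\to h(y)$ is dense in $Y$. $\Omega(T)$ is the set of $h\in\mathcal{L}(X)$ for which there is a single strictly increasing sequence of positive integers $(\omega_n)_n$ such that $\{x\in X:T^{\omega_n}x\to h(x)\}$ is dense in $X$. $T$ is quasi-rigid if $\mathrm{Id}\in\Omega(T)$. A collection $\{h_\ell\}_{\ell\in J}\subset\mathcal{L}(X)$ is simultaneously approximated by $T$ if for every $n\in\mathbb{N}$ and all members $g_1,\dots,g_n$ of the collection (repetitions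 allowed), the coordinatewise map $(g_1,\dots,g_n):X^n\to X^n$ belongs to $\Sigma\left(\bigoplus_{i=1}^nT\right)$. For quasi-rigid $T$, among the collections simultaneously approximated by $T$ that are contained in $\Omega(T)\cap\mathrm{GL}(X)$, there is a unique maximal one containing $\mathrm{Id}$; it is denoted $\mathcal{G}(T)$. $\mathrm{conv}_{\mathbb{K}}(M)=\left\{\sum_{i=1}^m\alpha_ix_i: x_i\in M,\ \alpha_i\in\mathbb{K},\ \sum_{i=1}^m\alpha_i=1\right\}$ is the affine hull of $M$; an affine manifold is a set $M$ with $(1-t)x+ty\in M$ for all $x,y\in M$, $t\in\mathbb{K}$. "$\mathcal{G}(T)$ is locally convex" means: every $g\in\mathcal{G}(T)$ has an open operator-norm ball $B(g,r)$ such that $\mathcal{G}(T)\cap B(g,r)$ is convex. *)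

theory Defs
  imports "HOL-Analysis.Analysis"
begin

section \<open>Scalars and F-spaces\<close>

text \<open>The scalar field is the real or the complex field, up to an isometric field isomorphism.
  Both \<^typ>\<open>real\<close> and \<^typ>\<open>complex\<close> are instances.\<close>

class real_or_complex = real_normed_field +
  assumes real_or_complex:
    "(\<exists>f :: 'a \<Rightarrow> real. bij f \<and> (\<forall>x y. f (x + y) = f x + f y) \<and> (\<forall>x y. f (x * y) = f x * f y)
        \<and> (\<forall>x. norm (f x) = norm x))
   \<or> (\<exists>f :: 'a \<Rightarrow> complex. bij f \<and> (\<forall>x y. f (x + y) = f x + f y) \<and> (\<forall>x y. f (x * y) = f x * f y)
        \<and> (\<forall>x. norm (f x) = norm x))"

instance real :: real_or_complex
  by (standard, rule disjI1, rule exI[of _ "\<lambda>x. x"]) (simp add: bij_def inj_def surj_def)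

instance complex :: real_or_complex
  by (standard, rule disjI2, rule exI[of _ "\<lambda>x. x"]) (simp add: bij_def inj_def surj_def)

text \<open>Joint continuity of addition comes from the class \<^class>\<open>topological_ab_group_add\<close>.\<close>

locale F_space = vector_space smul
  for smul :: "'k::real_or_complex \<Rightarrow> 'a::topological_ab_group_add \<Rightarrow> 'a" +
  assumes continuous_smul: "continuous_on UNIV (\<lambda>(c, x). smul c x)"
    and completely_metrizable: "completely_metrizable_space (euclidean :: 'a topology)"

definition infinite_dimensional :: "('k::field \<Rightarrow> 'a::ab_group_add \<Rightarrow> 'a) \<Rightarrow> bool" where
  "infinite_dimensional smul \<longleftrightarrow> \<not> (\<exists>B. finite B \<and> module.span smul B = UNIV)"

text \<open>A norm witnessing that the topological vector space is a Banach space: it is complete and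
  induces the given topology.\<close>

definition banach_norm ::
    "('k::real_normed_field \<Rightarrow> 'a::{ab_group_add,topological_space} \<Rightarrow> 'a) \<Rightarrow> ('a \<Rightarrow> real) \<Rightarrow> bool" where
  "banach_norm smul nrm \<longleftrightarrow>
     (\<forall>x. 0 \<le> nrm x) \<and> (\<forall>x. nrm x = 0 \<longleftrightarrow> x = 0) \<and>
     (\<forall>x y. nrm (x + y) \<le> nrm x + nrm y) \<and>
     (\<forall>c x. nrm (smul c x) = norm c * nrm x) \<and>
     Metric_space.mtopology UNIV (\<lambda>x y. nrm (x - y)) = euclidean \<and>
     Metric_space.mcomplete UNIV (\<lambda>x y. nrm (x - y))"


section \<open>Continuous linear operators\<close>

text \<open>Spaces are given here by a topology (whose \<^const>\<open>topspace\<close> is the carrier), an addition and a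
  scalar multiplication, because the powers \<open>X\<^sup>n\<close> with varying \<open>n\<close> are not types.\<close>

definition lin_ops_on ::
    "'b topology \<Rightarrow> ('b \<Rightarrow> 'b \<Rightarrow> 'b) \<Rightarrow> ('k \<Rightarrow> 'b \<Rightarrow> 'b) \<Rightarrow> ('b \<Rightarrow> 'b) set" where
  "lin_ops_on Y add scl = {h. continuous_map Y Y h \<and>
     (\<forall>x\<in>topspace Y. \<forall>y\<in>topspace Y. h (add x y) = add (h x) (h y)) \<and>
     (\<forall>c. \<forall>x\<in>topspace Y. h (scl c x) = scl c (h x))}"

definition Sigma_on ::
    "'b topology \<Rightarrow> ('b \<Rightarrow> 'b \<Rightarrow> 'b) \<Rightarrow> ('k \<Rightarrow> 'b \<Rightarrow> 'b) \<Rightarrow> ('b \<Rightarrow> 'b) \<Rightarrow> ('b \<Rightarrow> 'b) set" where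
  "Sigma_on Y add scl S = {h \<in> lin_ops_on Y add scl.
     Y closure_of {y \<in> topspace Y. \<exists>\<omega>::nat \<Rightarrow> nat. strict_mono \<omega> \<and> (\<forall>k. 0 < \<omega> k) \<and>
       limitin Y (\<lambda>k. (S ^^ \<omega> k) y) (h y) sequentially} = topspace Y}"

definition lin_ops ::
    "('k \<Rightarrow> 'a::{ab_group_add,topological_space} \<Rightarrow> 'a) \<Rightarrow> ('a \<Rightarrow> 'a) set" where
  "lin_ops smul = lin_ops_on euclidean (+) smul"

definition GL ::
    "('k \<Rightarrow> 'a::{ab_group_add,topological_space} \<Rightarrow> 'a) \<Rightarrow> ('a \<Rightarrow> 'a) set" where
  "GL smul = {h \<in> lin_ops smul. \<exists>k \<in> lin_ops smul. h \<circ> k = id \<and> k \<circ> h = id}"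

definition Omega ::
    "('k \<Rightarrow> 'a::{ab_group_add,topological_space} \<Rightarrow> 'a) \<Rightarrow> ('a \<Rightarrow> 'a) \<Rightarrow> ('a \<Rightarrow> 'a) set" where
  "Omega smul T = {h \<in> lin_ops smul. \<exists>\<omega>::nat \<Rightarrow> nat. strict_mono \<omega> \<and> (\<forall>k. 0 < \<omega> k) \<and>
     closure {x. (\<lambda>k. (T ^^ \<omega> k) x) \<longlonglongrightarrow> h x} = UNIV}"

definition quasi_rigid ::
    "('k \<Rightarrow> 'a::{ab_group_add,topological_space} \<Rightarrow> 'a) \<Rightarrow> ('a \<Rightarrow> 'a) \<Rightarrow> bool" where
  "quasi_rigid smul T \<longleftrightarrow> id \<in> Omega smul T"


section \<open>Simultaneous approximation\<close>

text \<open>The power \<open>X\<^sup>n\<close> consists of the extensional functions on \<open>{..<n}\<close>, with the product topology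
  and coordinatewise operations.\<close>

definition power_topology :: "nat \<Rightarrow> (nat \<Rightarrow> 'a::topological_space) topology" where
  "power_topology n = product_topology (\<lambda>_. euclidean) {..<n}"

definition power_add :: "nat \<Rightarrow> (nat \<Rightarrow> 'a::plus) \<Rightarrow> (nat \<Rightarrow> 'a) \<Rightarrow> (nat \<Rightarrow> 'a)" where
  "power_add n x y = (\<lambda>i\<in>{..<n}. x i + y i)"

definition power_smul :: "('k \<Rightarrow> 'a \<Rightarrow> 'a) \<Rightarrow> nat \<Rightarrow> 'k \<Rightarrow> (nat \<Rightarrow> 'a) \<Rightarrow> (nat \<Rightarrow> 'a)" where
  "power_smul smul n c x = (\<lambda>i\<in>{..<n}. smul c (x i))"

definition coordinatewise :: "nat \<Rightarrow> (nat \<Rightarrow> 'a \<Rightarrow> 'a) \<Rightarrow> (nat \<Rightarrow> 'a) \<Rightarrow> (nat \<Rightarrow> 'a)" where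
  "coordinatewise n g x = (\<lambda>i\<in>{..<n}. g i (x i))"

definition simultaneously_approximated ::
    "('k \<Rightarrow> 'a::{ab_group_add,topological_space} \<Rightarrow> 'a) \<Rightarrow> ('a \<Rightarrow> 'a) \<Rightarrow> ('a \<Rightarrow> 'a) set \<Rightarrow> bool" where
  "simultaneously_approximated smul T M \<longleftrightarrow> M \<subseteq> lin_ops smul \<and>
     (\<forall>n\<ge>1. \<forall>g. (\<forall>i<n. g i \<in> M) \<longrightarrow>
        coordinatewise n g \<in> Sigma_on (power_topology n) (power_add n) (power_smul smul n)
                               (coordinatewise n (\<lambda>_. T)))"

definition maximal_with :: "('b set \<Rightarrow> bool) \<Rightarrow> 'b set \<Rightarrow> bool" where
  "maximal_with P M \<longleftrightarrow> P M \<and> (\<forall>M'. P M' \<and> M \<subseteq> M' \<longrightarrow> M' = M)"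

definition maximal_approximated_with_id ::
    "('k \<Rightarrow> 'a::{ab_group_add,topological_space} \<Rightarrow> 'a) \<Rightarrow> ('a \<Rightarrow> 'a) \<Rightarrow> ('a \<Rightarrow> 'a) set \<Rightarrow> bool" where
  "maximal_approximated_with_id smul T N \<longleftrightarrow>
     maximal_with (simultaneously_approximated smul T) N \<and> id \<in> N"

text \<open>For quasi-rigid \<open>T\<close> the collection described here exists and is unique.\<close>

definition G_group ::
    "('k \<Rightarrow> 'a::{ab_group_add,topological_space} \<Rightarrow> 'a) \<Rightarrow> ('a \<Rightarrow> 'a) \<Rightarrow> ('a \<Rightarrow> 'a) set" where
  "G_group smul T = (THE G.
     maximal_with (\<lambda>M. simultaneously_approximated smul T M \<and> M \<subseteq> Omega smul T \<inter> GL smul) G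
     \<and> id \<in> G)"


section \<open>Affine and convex sets of operators\<close>

definition affine_hull_ops ::
    "('k::field \<Rightarrow> 'a::ab_group_add \<Rightarrow> 'a) \<Rightarrow> ('a \<Rightarrow> 'a) set \<Rightarrow> ('a \<Rightarrow> 'a) set" where
  "affine_hull_ops smul M =
     {(\<lambda>x. \<Sum>i=1..m. smul (\<alpha> i) (h i x)) | (m::nat) \<alpha> h.
        (\<forall>i\<in>{1..m}. h i \<in> M) \<and> (\<Sum>i=1..m. \<alpha> i) = 1}"

definition affine_manifold_ops ::
    "('k::field \<Rightarrow> 'a::ab_group_add \<Rightarrow> 'a) \<Rightarrow> ('a \<Rightarrow> 'a) set \<Rightarrow> bool" where
  "affine_manifold_ops smul M \<longleftrightarrow>
     (\<forall>g\<in>M. \<forall>h\<in>M. \<forall>t. (\<lambda>x. smul (1 - t) (g x) + smul t (h x)) \<in> M)"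

definition convex_ops ::
    "('k::real_normed_field \<Rightarrow> 'a::ab_group_add \<Rightarrow> 'a) \<Rightarrow> ('a \<Rightarrow> 'a) set \<Rightarrow> bool" where
  "convex_ops smul M \<longleftrightarrow>
     (\<forall>g\<in>M. \<forall>h\<in>M. \<forall>t::real. 0 \<le> t \<and> t \<le> 1 \<longrightarrow>
        (\<lambda>x. smul (of_real (1 - t)) (g x) + smul (of_real t) (h x)) \<in> M)"

text \<open>The same formula as \<^const>\<open>onorm\<close>, for a norm that does not come from a type class.\<close>

definition op_norm :: "('a \<Rightarrow> real) \<Rightarrow> ('a \<Rightarrow> 'a) \<Rightarrow> real" where
  "op_norm nrm h = (SUP x. nrm (h x) / nrm x)"

definition op_ball ::
    "('k \<Rightarrow> 'a::{ab_group_add,topological_space} \<Rightarrow> 'a) \<Rightarrow> ('a \<Rightarrow> real) \<Rightarrow> ('a \<Rightarrow> 'a) \<Rightarrow> real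
      \<Rightarrow> ('a \<Rightarrow> 'a) set" where
  "op_ball smul nrm g r = {h \<in> lin_ops smul. op_norm nrm (\<lambda>x. h x - g x) < r}"

definition locally_convex_ops ::
    "('k::real_normed_field \<Rightarrow> 'a::{ab_group_add,topological_space} \<Rightarrow> 'a) \<Rightarrow> ('a \<Rightarrow> real)
      \<Rightarrow> ('a \<Rightarrow> 'a) set \<Rightarrow> bool" where
  "locally_convex_ops smul nrm M \<longleftrightarrow>
     (\<forall>g\<in>M. \<exists>r>0. convex_ops smul (M \<inter> op_ball smul nrm g r))"

end

theory Submission
  imports Defs
begin

text \<open>
  A collection \<open>M\<close> of operators is simultaneously approximated by \<open>T\<close> iff finitely many points
  \<open>(u i, g i (u i))\<close> with \<open>g i \<in> M\<close> can be approximated by points \<open>(x i, T ^^ m (x i))\<close> with one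
  arbitrarily large exponent \<open>m\<close> (\<open>simultaneously_approximated_iff\<close>). Passing from approximations to
  convergent subsequences of orbits is an application of Baire's theorem in a countable product of
  open subsets of \<open>X\<close>. In a separable space the same argument, with a sequence of open
  sets that forces the resulting points to be dense, shows that every member of an approximated
  collection lies in \<open>\<Omega>(T)\<close>, so that this condition can be dropped from the definition of
  \<open>\<G>(T)\<close>.

  Two stability properties of this approximation of graphs carry the theorem.

  \<^item> If \<open>M\<close> and \<open>N\<close> are approximated and the members of \<open>N\<close> are invertible, then the compositions
  \<open>g \<circ> h\<close> with \<open>g \<in> M\<close>, \<open>h \<in> N\<close> form an approximated collection (\<open>graph_approximated_compose\<close>): the
  exponents add up, and invertibility of \<open>h\<close> makes the image of a neighbourhood of \<open>u\<close> a
  neighbourhood of \<open>h u\<close>. If both contain the identity, it follows that \<open>M \<union> N\<close> is approximated. A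
  maximal collection \<open>N\<close> with \<open>id \<in> N\<close> therefore contains every approximated collection of invertible
  operators with the identity, whence \<open>\<G>(T) = N \<inter> GL(X)\<close>.

  \<^item> The affine hull of an approximated collection is approximated
  (\<open>graph_approximated_affine_hull\<close>), because affine combinations of points near \<open>u\<close> are near \<open>u\<close>. A
  maximal collection is therefore equal to its affine hull.

  In a Banach space \<open>GL(X)\<close> is open, so near each of its members \<open>\<G>(T)\<close> agrees with the affine
  manifold \<open>N\<close>; this gives local convexity. If \<open>h \<in> N\<close> and \<open>t \<noteq> 0\<close> is small, then
  \<open>f = (1 - t) id + t h\<close> belongs to \<open>N \<inter> GL(X) = \<G>(T)\<close>, and \<open>h\<close> is an affine combination of \<open>id\<close> and \<open>f\<close>.
  Hence \<open>N\<close> is the affine hull of \<open>\<G>(T)\<close>, which determines \<open>N\<close>; a maximal \<open>N\<close> exists by Zorn's lemma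
  since \<open>{id}\<close> is approximated.
\<close>

section \<open>Continuous linear operators\<close>

context F_space
begin

lemma lin_ops_iff:
  "h \<in> lin_ops smul \<longleftrightarrow> continuous_on UNIV h \<and> (\<forall>x y. h (x + y) = h x + h y) \<and>
     (\<forall>c x. h (smul c x) = smul c (h x))"
  by (auto simp: lin_ops_def lin_ops_on_def)

lemma continuous_on_smul [continuous_intros]:
  "continuous_on S f \<Longrightarrow> continuous_on S g \<Longrightarrow> continuous_on S (\<lambda>x. smul (f x) (g x))"
  using continuous_on_compose2 [OF continuous_smul, of S "\<lambda>x. (f x, g x)"]
  by (simp add: continuous_on_Pair)

lemma lin_ops_continuous: "h \<in> lin_ops smul \<Longrightarrow> continuous_on UNIV h"
  by (simp add: lin_ops_iff)

lemma lin_ops_add: "h \<in> lin_ops smul \<Longrightarrow> h (x + y) = h x + h y"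
  and lin_ops_smul: "h \<in> lin_ops smul \<Longrightarrow> h (smul c x) = smul c (h x)"
  by (simp_all add: lin_ops_iff)

lemma lin_ops_zero: "h \<in> lin_ops smul \<Longrightarrow> h 0 = 0"
  using lin_ops_smul [of h 0 0] by simp

lemma lin_ops_diff: "h \<in> lin_ops smul \<Longrightarrow> h (x - y) = h x - h y"
  by (metis add_diff_cancel_right' diff_add_cancel lin_ops_add)

lemma lin_ops_sum: "h \<in> lin_ops smul \<Longrightarrow> h (sum f I) = (\<Sum>i\<in>I. h (f i))"
  by (induction I rule: infinite_finite_induct) (auto simp: lin_ops_zero lin_ops_add)

lemma lin_ops_id: "id \<in> lin_ops smul"
  by (simp add: lin_ops_iff)

lemma lin_ops_compose: "g \<in> lin_ops smul \<Longrightarrow> h \<in> lin_ops smul \<Longrightarrow> g \<circ> h \<in> lin_ops smul"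
  by (auto simp: lin_ops_iff intro: continuous_on_compose2)

lemma lin_ops_funpow: "h \<in> lin_ops smul \<Longrightarrow> h ^^ n \<in> lin_ops smul"
  by (induction n) (auto simp: lin_ops_id lin_ops_compose)

lemma lin_ops_linear_combination:
  assumes "\<And>i. i \<in> I \<Longrightarrow> h i \<in> lin_ops smul"
  shows "(\<lambda>x. \<Sum>i\<in>I. smul (\<alpha> i) (h i x)) \<in> lin_ops smul"
  unfolding lin_ops_iff
proof (intro conjI allI)
  show "continuous_on UNIV (\<lambda>x. \<Sum>i\<in>I. smul (\<alpha> i) (h i x))"
    by (intro continuous_intros lin_ops_continuous assms)
  show "(\<Sum>i\<in>I. smul (\<alpha> i) (h i (x + y)))
      = (\<Sum>i\<in>I. smul (\<alpha> i) (h i x)) + (\<Sum>i\<in>I. smul (\<alpha> i) (h i y))" for x y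
    by (simp add: assms lin_ops_add scale_right_distrib sum.distrib)
  show "(\<Sum>i\<in>I. smul (\<alpha> i) (h i (smul c x))) = smul c (\<Sum>i\<in>I. smul (\<alpha> i) (h i x))" for c x
    by (simp add: assms lin_ops_smul scale_sum_right mult.commute)
qed

lemma lin_ops_minus_op: "g \<in> lin_ops smul \<Longrightarrow> h \<in> lin_ops smul \<Longrightarrow> (\<lambda>x. g x - h x) \<in> lin_ops smul"
  by (auto simp: lin_ops_iff algebra_simps intro: continuous_intros)

lemma GL_subset: "GL smul \<subseteq> lin_ops smul"
  by (auto simp: GL_def)

lemma GL_id: "id \<in> GL smul"
  by (auto simp: GL_def lin_ops_id)

lemma GL_compose:
  assumes "g \<in> GL smul" "h \<in> GL smul" shows "g \<circ> h \<in> GL smul"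
proof -
  obtain g' h' where *: "g' \<in> lin_ops smul" "g \<circ> g' = id" "g' \<circ> g = id"
    "h' \<in> lin_ops smul" "h \<circ> h' = id" "h' \<circ> h = id"
    using assms unfolding GL_def by auto
  then have "(g \<circ> h) \<circ> (h' \<circ> g') = id" "(h' \<circ> g') \<circ> (g \<circ> h) = id"
    by (metis comp_assoc comp_id)+
  with * assms show ?thesis
    unfolding GL_def using lin_ops_compose by blast
qed

lemma countable_nhds_zero:
  obtains B :: "nat \<Rightarrow> 'a set" where "\<And>k. open (B k)" "\<And>k. 0 \<in> B k"
    "\<And>V. open V \<Longrightarrow> 0 \<in> V \<Longrightarrow> \<exists>k. \<forall>j\<ge>k. B j \<subseteq> V"
proof -
  obtain M d where M: "Metric_space M d" "(euclidean :: 'a topology) = Metric_space.mtopology M d"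
    using completely_metrizable unfolding completely_metrizable_space_def by blast
  then interpret Metric_space M d by blast
  have UN: "M = UNIV"
    using M(2) topspace_mtopology by (metis topspace_euclidean)
  define B where "B k = mball 0 (1 / real (Suc k))" for k
  show thesis
  proof
    show "open (B k)" for k
      using openin_mball M(2) unfolding B_def by (metis open_openin)
    show "0 \<in> B k" for k
      unfolding B_def by (rule centre_in_mball_iff [THEN iffD2]) (simp add: UN)
    show "\<exists>k. \<forall>j\<ge>k. B j \<subseteq> V" if V: "open V" "0 \<in> V" for V
    proof -
      obtain r where r: "r > 0" "mball 0 r \<subseteq> V"
        using V M(2) openin_mtopology by (metis open_openin)
      obtain k where k: "1 / real (Suc k) < r"
        using r(1) nat_approx_posE by blast
      have "B j \<subseteq> mball 0 r" if "j \<ge> k" for j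
      proof -
        have "1 / real (Suc j) \<le> 1 / real (Suc k)"
          using that by (simp add: frac_le)
        with k show ?thesis
          unfolding B_def by (intro mball_subset_concentric) linarith
      qed
      with r(2) show ?thesis by blast
    qed
  qed
qed

end


section \<open>Simultaneous approximation in terms of graphs\<close>

text \<open>The finite tuples of points of the graphs of members of \<open>M\<close> are limits of points of the
  graphs of high powers of \<open>T\<close>, with the same power in all coordinates. In contrast to
  \<^const>\<open>simultaneously_approximated\<close>, the approximating points need not have
  orbits that converge along a subsequence, and the powers \<open>X\<^sup>n\<close> do not appear.\<close>

definition graph_approximated ::
    "('a::topological_space \<Rightarrow> 'a) \<Rightarrow> ('a \<Rightarrow> 'a) set \<Rightarrow> bool" where
  "graph_approximated T M \<longleftrightarrow> (\<forall>n::nat. \<forall>g u A B. \<forall>K::nat.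
     (\<forall>i<n. g i \<in> M \<and> open (A i) \<and> u i \<in> A i \<and> open (B i) \<and> g i (u i) \<in> B i) \<longrightarrow>
     (\<exists>m>K. \<forall>i<n. \<exists>x\<in>A i. (T ^^ m) x \<in> B i))"

lemma graph_approximatedD:
  assumes "graph_approximated T M" "finite I"
    and "\<And>i. i \<in> I \<Longrightarrow> g i \<in> M \<and> open (A i) \<and> u i \<in> A i \<and> open (B i) \<and> g i (u i) \<in> B i"
  shows "\<exists>m>K. \<exists>x. \<forall>i\<in>I. x i \<in> A i \<and> (T ^^ m) (x i) \<in> B i"
proof -
  obtain f where f: "bij_betw f {0..<card I} I"
    using ex_bij_betw_nat_finite [OF \<open>finite I\<close>] by blast
  then have fI: "f i \<in> I" if "i < card I" for i
    using that by (auto simp: bij_betw_def)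
  have "\<exists>m>K. \<forall>j<card I. \<exists>x\<in>(A \<circ> f) j. (T ^^ m) x \<in> (B \<circ> f) j"
    using assms(1) unfolding graph_approximated_def
    by (elim allE [of _ "card I"] allE [of _ "g \<circ> f"] allE [of _ "u \<circ> f"] allE [of _ "A \<circ> f"]
        allE [of _ "B \<circ> f"] allE [of _ K]) (use fI assms(3) in auto)
  then obtain m where m: "m > K" "\<And>j. j < card I \<Longrightarrow> \<exists>x\<in>A (f j). (T ^^ m) x \<in> B (f j)"
    by auto
  have "\<exists>x\<in>A i. (T ^^ m) x \<in> B i" if "i \<in> I" for i
  proof -
    have "i \<in> f ` {0..<card I}"
      using bij_betw_imp_surj_on [OF f] that by simp
    then obtain j where "j < card I" "f j = i"
      by auto
    then show ?thesis
      using m(2) by blast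
  qed
  then have "\<exists>x. \<forall>i\<in>I. x i \<in> A i \<and> (T ^^ m) (x i) \<in> B i"
    by (intro bchoice) blast
  with m(1) show ?thesis by blast
qed

lemma graph_approximated_mono:
  assumes "graph_approximated T M" "M' \<subseteq> M"
  shows "graph_approximated T M'"
  unfolding graph_approximated_def
proof (intro allI impI)
  fix n K :: nat and g u A B
  assume *: "\<forall>i<n. g i \<in> M' \<and> open (A i) \<and> u i \<in> A i \<and> open (B i) \<and> g i (u i) \<in> B i"
  have "\<exists>m>K. \<exists>x. \<forall>i\<in>{..<n}. x i \<in> A i \<and> (T ^^ m) (x i) \<in> B i"
    by (rule graph_approximatedD [OF assms(1) finite_lessThan, where g = g and u = u])
      (use * subsetD [OF assms(2)] in simp)
  then show "\<exists>m>K. \<forall>i<n. \<exists>x\<in>A i. (T ^^ m) x \<in> B i"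
    by auto
qed

lemma graph_approximated_Union_chain:
  assumes "subset.chain \<A> \<C>" "\<C> \<noteq> {}" and "\<And>M. M \<in> \<C> \<Longrightarrow> graph_approximated T M"
  shows "graph_approximated T (\<Union>\<C>)"
  unfolding graph_approximated_def
proof (intro allI impI)
  fix n K :: nat and g u A B
  assume *: "\<forall>i<n. g i \<in> \<Union>\<C> \<and> open (A i) \<and> u i \<in> A i \<and> open (B i) \<and> g i (u i) \<in> B i"
  have "finite (g ` {..<n})" "g ` {..<n} \<subseteq> \<Union>\<C>"
    using * by auto
  then obtain M where "M \<in> \<C>" "g ` {..<n} \<subseteq> M"
    using finite_subset_Union_chain assms(1,2) by metis
  then have "\<exists>m>K. \<exists>x. \<forall>i\<in>{..<n}. x i \<in> A i \<and> (T ^^ m) (x i) \<in> B i"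
    using * by (intro graph_approximatedD [OF assms(3) finite_lessThan, where g = g and u = u]) auto
  then show "\<exists>m>K. \<forall>i<n. \<exists>x\<in>A i. (T ^^ m) x \<in> B i"
    by auto
qed

lemma convergent_orbits_enter:
  fixes n :: nat
  assumes "strict_mono \<omega>" and lim: "\<And>i. i < n \<Longrightarrow> (\<lambda>k. (T ^^ \<omega> k) (x i)) \<longlonglongrightarrow> l i"
    and B: "\<And>i. i < n \<Longrightarrow> open (B i)" "\<And>i. i < n \<Longrightarrow> l i \<in> B i"
  shows "\<exists>m>K. \<forall>i<n. (T ^^ m) (x i) \<in> B i"
proof -
  have "\<forall>\<^sub>F k in sequentially. (T ^^ \<omega> k) (x i) \<in> B i" if "i < n" for i
    using topological_tendstoD [OF lim B] that by blast
  then have "\<forall>\<^sub>F k in sequentially. \<forall>i\<in>{..<n}. (T ^^ \<omega> k) (x i) \<in> B i"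
    by (intro eventually_ball_finite) auto
  moreover have "\<forall>\<^sub>F k in sequentially. K < \<omega> k"
    using filterlim_subseq [OF \<open>strict_mono \<omega>\<close>]
    unfolding filterlim_at_top Suc_le_eq [symmetric] by blast
  ultimately have "\<exists>k. (\<forall>i\<in>{..<n}. (T ^^ \<omega> k) (x i) \<in> B i) \<and> K < \<omega> k"
    by (intro eventually_happens' [OF sequentially_bot] eventually_conj)
  then show ?thesis by auto
qed

lemma funpow_coordinatewise:
  "y \<in> extensional {..<n} \<Longrightarrow>
    (coordinatewise n (\<lambda>_. T) ^^ k) y = (\<lambda>i\<in>{..<n}. (T ^^ k) (y i))"
  by (induction k) (auto simp: coordinatewise_def extensional_def fun_eq_iff)

lemma topspace_power_topology: "topspace (power_topology n) = extensional {..<n}"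
  by (auto simp: power_topology_def PiE_def)

context F_space
begin

text \<open>Baire category in a countable product of open sets yields convergence along one common
  sequence of exponents.\<close>

lemma graph_approximated_imp_common_sequence:
  fixes g :: "nat \<Rightarrow> 'a \<Rightarrow> 'a"
  assumes T: "T \<in> lin_ops smul" and M: "M \<subseteq> lin_ops smul" and appr: "graph_approximated T M"
    and g: "\<And>i. g i \<in> M" and U: "\<And>i. open (U i)" "\<And>i. U i \<noteq> {}"
  obtains x and \<omega> :: "nat \<Rightarrow> nat" where "strict_mono \<omega>" "\<And>k. 0 < \<omega> k" "\<And>i. x i \<in> U i"
    "\<And>i. (\<lambda>k. (T ^^ \<omega> k) (x i)) \<longlonglongrightarrow> g i (x i)"
proof -
  have gl: "g i \<in> lin_ops smul" for i
    using g M by blast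
  obtain B :: "nat \<Rightarrow> 'a set" where B: "\<And>k. open (B k)" "\<And>k. 0 \<in> B k"
      "\<And>V. open V \<Longrightarrow> 0 \<in> V \<Longrightarrow> \<exists>k. \<forall>j\<ge>k. B j \<subseteq> V"
    using countable_nhds_zero by blast
  define P where "P = product_topology (\<lambda>i. top_of_set (U i)) UNIV"
  have topP: "topspace P = {x. \<forall>i. x i \<in> U i}"
    by (auto simp: P_def PiE_def Pi_def)
  define D where "D k = {x \<in> topspace P. \<exists>m>k. \<forall>i\<le>k. (T ^^ m) (x i) - g i (x i) \<in> B k}" for k
  have open_D: "openin P (D k)" for k
  proof -
    have cont: "continuous_map P euclidean (\<lambda>x. (T ^^ m) (x i) - g i (x i))" for m i
    proof -
      have "continuous_map P (top_of_set (U i)) (\<lambda>x. x i)"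
        unfolding P_def by (rule continuous_map_product_projection) simp
      then have "continuous_map P euclidean (\<lambda>x. x i)"
        by (rule continuous_map_into_fulltopology)
      moreover have "continuous_map euclidean euclidean (\<lambda>y. (T ^^ m) y - g i y)"
        using lin_ops_continuous [OF lin_ops_minus_op [OF lin_ops_funpow [OF T] gl]] by simp
      ultimately show ?thesis
        using continuous_map_compose [of P euclidean "\<lambda>x. x i" euclidean "\<lambda>y. (T ^^ m) y - g i y"]
        by (simp add: o_def)
    qed
    have "openin P {x \<in> topspace P. (T ^^ m) (x i) - g i (x i) \<in> B k}" for m i
      using openin_continuous_map_preimage [OF cont] B(1) by simp
    then have "openin P (\<Inter>i\<in>{..k}. {x \<in> topspace P. (T ^^ m) (x i) - g i (x i) \<in> B k})" for m
      by (intro openin_INT2) auto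
    then have "openin P (\<Union>m\<in>{k<..}. \<Inter>i\<in>{..k}. {x \<in> topspace P. (T ^^ m) (x i) - g i (x i) \<in> B k})"
      by (intro openin_Union) auto
    moreover have "(\<Union>m\<in>{k<..}. \<Inter>i\<in>{..k}. {x \<in> topspace P. (T ^^ m) (x i) - g i (x i) \<in> B k}) = D k"
      by (auto simp: D_def)
    ultimately show ?thesis by simp
  qed
  have dense_D: "P closure_of D k = topspace P" for k
    unfolding dense_intersects_open
  proof (intro allI impI)
    fix W assume "openin P W \<and> W \<noteq> {}"
    then obtain y where y: "openin P W" "y \<in> W" by auto
    then obtain V where V: "\<And>i. openin (top_of_set (U i)) (V i)" "y \<in> Pi\<^sub>E UNIV V" "Pi\<^sub>E UNIV V \<subseteq> W"
      unfolding P_def openin_product_topology_alt by (metis UNIV_I)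
    have V': "open (V i)" "V i \<subseteq> U i" "y i \<in> V i" for i
      using V(1) [of i] V(2) U(1) [of i] by (auto simp: openin_open_eq)
    \<comment> \<open>Continuity of \<open>(a, b) \<mapsto> b - g i a\<close> at a point of the graph of \<open>g i\<close>.\<close>
    have "\<exists>A C. open A \<and> open C \<and> y i \<in> A \<and> g i (y i) \<in> C \<and> A \<subseteq> V i
        \<and> (\<forall>a\<in>A. \<forall>b\<in>C. b - g i a \<in> B k)" for i
    proof -
      have "continuous_on UNIV (\<lambda>p::'a \<times> 'a. snd p - g i (fst p))"
        by (intro continuous_intros continuous_on_compose2 [OF lin_ops_continuous [OF gl]]) auto
      then have "open ((\<lambda>p. snd p - g i (fst p)) -` B k)"
        using B(1) open_vimage by blast
      moreover have "(y i, g i (y i)) \<in> (\<lambda>p. snd p - g i (fst p)) -` B k"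
        using B(2) by simp
      ultimately obtain A C where AC: "open A" "open C" "(y i, g i (y i)) \<in> A \<times> C"
          "A \<times> C \<subseteq> (\<lambda>p. snd p - g i (fst p)) -` B k"
        by (rule open_prod_elim)
      then have "\<forall>a\<in>A. \<forall>b\<in>C. b - g i a \<in> B k"
        by (force simp: subset_iff)
      with AC V' show ?thesis
        by (intro exI [of _ "A \<inter> V i"] exI [of _ C]) auto
    qed
    then obtain A C where AC: "\<And>i. open (A i)" "\<And>i. open (C i)" "\<And>i. y i \<in> A i"
        "\<And>i. g i (y i) \<in> C i" "\<And>i. A i \<subseteq> V i" "\<And>i a b. a \<in> A i \<Longrightarrow> b \<in> C i \<Longrightarrow> b - g i a \<in> B k"
      by metis
    have "\<exists>m>k. \<exists>x. \<forall>i\<in>{..k}. x i \<in> A i \<and> (T ^^ m) (x i) \<in> C i"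
      by (rule graph_approximatedD [OF appr finite_atMost, where g = g and u = y]) (intro conjI g AC)
    then obtain m x where mx: "m > k" "\<forall>i\<in>{..k}. x i \<in> A i \<and> (T ^^ m) (x i) \<in> C i"
      by blast
    define z where "z i = (if i \<le> k then x i else y i)" for i
    have "z i \<in> V i" for i
      using mx(2) AC(5) V'(3) by (auto simp: z_def)
    then have "z \<in> W" "z \<in> topspace P"
      using V(3) V'(2) by (auto simp: topP PiE_def)
    moreover have "(T ^^ m) (z i) - g i (z i) \<in> B k" if "i \<le> k" for i
      using mx AC(6) that by (simp add: z_def)
    ultimately have "z \<in> D k \<inter> W"
      using mx(1) by (auto simp: D_def)
    then show "D k \<inter> W \<noteq> {}" by blast
  qed
  have "completely_metrizable_space P"
    unfolding P_def completely_metrizable_space_product_topology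
    using completely_metrizable_space_openin [OF completely_metrizable] U(1) by auto
  then have "P closure_of \<Inter>(range D) = topspace P"
    by (intro Baire_category) (use open_D dense_D in auto)
  moreover have "topspace P \<noteq> {}"
    using U(2) unfolding topP by (auto simp: ex_in_conv [symmetric] intro: choice)
  ultimately obtain x where x: "\<And>k. x \<in> D k"
    by (metis INT_E UNIV_I closure_of_empty ex_in_conv)
  then have near: "\<exists>m>k. \<forall>i\<le>k. (T ^^ m) (x i) - g i (x i) \<in> B k" for k
    by (auto simp: D_def)
  \<comment> \<open>The exponent \<open>m\<close> is good at stage \<open>k\<close>. The level \<open>l\<close> may exceed \<open>k\<close>, which makes room for exponents
    larger than the previous one.\<close>
  define Q where "Q k m \<longleftrightarrow> 0 < m \<and> (\<exists>l\<ge>k. \<forall>i\<le>l. (T ^^ m) (x i) - g i (x i) \<in> B l)" for k m :: nat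
  have "\<exists>\<omega>. \<forall>k. Q k (\<omega> k) \<and> \<omega> k < \<omega> (Suc k)"
  proof (rule dependent_nat_choice)
    show "\<exists>m. Q 0 m"
      using near [of 0] unfolding Q_def by blast
    show "\<exists>m'. Q (Suc k) m' \<and> m < m'" for m k
    proof -
      obtain m' where "m' > max m (Suc k)"
          "\<forall>i\<le>max m (Suc k). (T ^^ m') (x i) - g i (x i) \<in> B (max m (Suc k))"
        using near by blast
      then show ?thesis
        unfolding Q_def by (intro exI [of _ m'] conjI exI [of _ "max m (Suc k)"]) auto
    qed
  qed
  then obtain \<omega> where \<omega>: "\<And>k. Q k (\<omega> k)" "\<And>k. \<omega> k < \<omega> (Suc k)" by blast
  show thesis
  proof
    show "strict_mono \<omega>"
      by (simp add: strict_mono_Suc_iff \<omega>(2))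
    show "0 < \<omega> k" for k
      using \<omega>(1) by (simp add: Q_def)
    show "x i \<in> U i" for i
      using x [of 0] by (simp add: D_def topP)
    show "(\<lambda>k. (T ^^ \<omega> k) (x i)) \<longlonglongrightarrow> g i (x i)" for i
    proof -
      have "(\<lambda>k. (T ^^ \<omega> k) (x i) - g i (x i)) \<longlonglongrightarrow> 0"
      proof (rule topological_tendstoI)
        fix V :: "'a set" assume "open V" "0 \<in> V"
        then obtain j where j: "\<forall>l\<ge>j. B l \<subseteq> V"
          using B(3) by blast
        have "(T ^^ \<omega> k) (x i) - g i (x i) \<in> V" if "k \<ge> max i j" for k
        proof -
          obtain l where "l \<ge> k" "\<forall>i\<le>l. (T ^^ \<omega> k) (x i) - g i (x i) \<in> B l"
            using \<omega>(1) [of k] unfolding Q_def by blast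
          with j that show ?thesis
            by (meson le_trans max.bounded_iff subsetD)
        qed
        then show "\<forall>\<^sub>F k in sequentially. (T ^^ \<omega> k) (x i) - g i (x i) \<in> V"
          unfolding eventually_sequentially by blast
      qed
      then have "(\<lambda>k. ((T ^^ \<omega> k) (x i) - g i (x i)) + g i (x i)) \<longlonglongrightarrow> 0 + g i (x i)"
        by (intro tendsto_add tendsto_const)
      then show ?thesis by simp
    qed
  qed
qed

lemma coordinatewise_lin_ops_on:
  assumes "\<And>i. i < n \<Longrightarrow> g i \<in> lin_ops smul"
  shows "coordinatewise n g \<in> lin_ops_on (power_topology n) (power_add n) (power_smul smul n)"
proof -
  have "continuous_map (power_topology n) euclidean (\<lambda>x. g i (x i))" if "i < n" for i
  proof -
    have "continuous_map (power_topology n) euclidean (\<lambda>x. x i)"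
      unfolding power_topology_def by (rule continuous_map_product_projection) (use that in simp)
    moreover have "continuous_map euclidean euclidean (g i)"
      using lin_ops_continuous [OF assms [OF that]] by simp
    ultimately show ?thesis
      using continuous_map_compose [of _ euclidean "\<lambda>x. x i" euclidean "g i"] by (simp add: o_def)
  qed
  then have "continuous_map (power_topology n) (power_topology n) (coordinatewise n g)"
    unfolding power_topology_def [of n] coordinatewise_def
    by (subst continuous_map_componentwise) (auto simp: power_topology_def)
  then show ?thesis
    using assms by (auto simp: lin_ops_on_def coordinatewise_def power_add_def power_smul_def
        fun_eq_iff lin_ops_add lin_ops_smul)
qed

lemma limitin_power_topology:
  assumes "y \<in> extensional {..<n}"
  shows "limitin (power_topology n) (\<lambda>k. (coordinatewise n (\<lambda>_. T) ^^ \<omega> k) y) (coordinatewise n g y) F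
    \<longleftrightarrow> (\<forall>i<n. ((\<lambda>k. (T ^^ \<omega> k) (y i)) \<longlongrightarrow> g i (y i)) F)"
  using assms
  by (auto simp: power_topology_def limitin_componentwise funpow_coordinatewise coordinatewise_def)

text \<open>A point whose orbit converges along a subsequence gives approximations in the graphs of high
  powers of \<open>T\<close>. Conversely, such approximations are turned into convergence by the preceding Baire
  category argument.\<close>

lemma simultaneously_approximated_iff:
  assumes T: "T \<in> lin_ops smul"
  shows "simultaneously_approximated smul T M \<longleftrightarrow> M \<subseteq> lin_ops smul \<and> graph_approximated T M"
proof (intro iffI conjI)
  assume sa: "simultaneously_approximated smul T M"
  then show M: "M \<subseteq> lin_ops smul"
    by (simp add: simultaneously_approximated_def)
  show "graph_approximated T M"
    unfolding graph_approximated_def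
  proof (intro allI impI)
    fix n K :: nat and g u A B
    assume *: "\<forall>i<n. g i \<in> M \<and> open (A i) \<and> u i \<in> A i \<and> open (B i) \<and> g i (u i) \<in> B i"
    show "\<exists>m>K. \<forall>i<n. \<exists>x\<in>A i. (T ^^ m) x \<in> B i"
    proof (cases "n = 0")
      case False
      let ?Y = "power_topology n :: (nat \<Rightarrow> 'a) topology"
      let ?S = "{y \<in> topspace ?Y. \<exists>\<omega>::nat \<Rightarrow> nat. strict_mono \<omega> \<and> (\<forall>k. 0 < \<omega> k) \<and>
        limitin ?Y (\<lambda>k. (coordinatewise n (\<lambda>_. T) ^^ \<omega> k) y) (coordinatewise n g y) sequentially}"
      let ?W = "Pi\<^sub>E {..<n} (\<lambda>i. A i \<inter> g i -` B i)"
      have dense: "?Y closure_of ?S = topspace ?Y"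
        using sa * False by (simp add: simultaneously_approximated_def Sigma_on_def Suc_le_eq)
      have "open (A i \<inter> g i -` B i)" if "i < n" for i
        using * that M lin_ops_continuous [of "g i"] by (auto intro: open_vimage)
      then have "openin ?Y ?W"
        unfolding power_topology_def by (simp add: openin_PiE_gen)
      moreover have "restrict u {..<n} \<in> ?W"
        using * by auto
      then have "?W \<noteq> {}" by blast
      ultimately have "?S \<inter> ?W \<noteq> {}"
        by (intro dense [unfolded dense_intersects_open, rule_format] conjI)
      then obtain y where y: "y \<in> ?S" "y \<in> ?W"
        by (metis (no_types, lifting) IntE ex_in_conv)
      have "y \<in> extensional {..<n}"
        using y(2) by (simp add: PiE_def)
      with y(1) obtain \<omega> :: "nat \<Rightarrow> nat" where \<omega>: "strict_mono \<omega>"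
          "\<And>i. i < n \<Longrightarrow> (\<lambda>k. (T ^^ \<omega> k) (y i)) \<longlonglongrightarrow> g i (y i)"
        unfolding mem_Collect_eq limitin_power_topology [OF \<open>y \<in> extensional {..<n}\<close>] by blast
      have yAB: "y i \<in> A i" "g i (y i) \<in> B i" if "i < n" for i
        using y(2) that by (auto simp: PiE_iff)
      have "\<exists>m>K. \<forall>i<n. (T ^^ m) (y i) \<in> B i"
        by (rule convergent_orbits_enter [OF \<omega>]) (use * yAB(2) in simp_all)
      with yAB(1) show ?thesis by blast
    qed auto
  qed
next
  assume M: "M \<subseteq> lin_ops smul \<and> graph_approximated T M"
  show "simultaneously_approximated smul T M"
    unfolding simultaneously_approximated_def Sigma_on_def dense_intersects_open
  proof (intro conjI allI impI CollectI)
    fix n :: nat and g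
    assume n: "1 \<le> n" and g: "\<forall>i<n. g i \<in> M"
    show "coordinatewise n g \<in> lin_ops_on (power_topology n) (power_add n) (power_smul smul n)"
      using g M by (intro coordinatewise_lin_ops_on) auto
    fix W :: "(nat \<Rightarrow> 'a) set"
    assume "openin (power_topology n) W \<and> W \<noteq> {}"
    then obtain y where y: "openin (power_topology n) W" "y \<in> W" by auto
    then have "\<exists>V. (\<forall>i\<in>{..<n}. openin euclidean (V i)) \<and> y \<in> Pi\<^sub>E {..<n} V \<and> Pi\<^sub>E {..<n} V \<subseteq> W"
      unfolding power_topology_def openin_product_topology_alt by blast
    then obtain V where V: "\<forall>i\<in>{..<n}. openin euclidean (V i)" "y \<in> Pi\<^sub>E {..<n} V" "Pi\<^sub>E {..<n} V \<subseteq> W"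
      by (elim exE conjE)
    \<comment> \<open>The \<open>n\<close>-tuples are padded to sequences; \<open>g 0 \<in> M\<close> because \<open>1 \<le> n\<close>.\<close>
    define g' where "g' i = (if i < n then g i else g 0)" for i
    define U where "U i = (if i < n then V i else UNIV)" for i
    have g': "g' i \<in> M" for i
      using g n by (simp add: g'_def)
    have U: "open (U i)" "U i \<noteq> {}" for i
      using V(1,2) by (auto simp: U_def PiE_iff)
    obtain x and \<omega> :: "nat \<Rightarrow> nat" where x: "strict_mono \<omega>" "\<And>k. 0 < \<omega> k"
        "\<And>i. x i \<in> U i" "\<And>i. (\<lambda>k. (T ^^ \<omega> k) (x i)) \<longlonglongrightarrow> g' i (x i)"
      by (rule graph_approximated_imp_common_sequence [OF T M [THEN conjunct1] M [THEN conjunct2], of g' U, OF g' U]) (rule that)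
    have "x i \<in> V i" if "i < n" for i
      using x(3) [of i] that by (simp add: U_def)
    then have xV: "restrict x {..<n} \<in> Pi\<^sub>E {..<n} V"
      by simp
    have "(\<lambda>k. (T ^^ \<omega> k) (restrict x {..<n} i)) \<longlonglongrightarrow> g i (restrict x {..<n} i)" if "i < n" for i
      using x(4) [of i] that by (simp add: g'_def)
    then have "limitin (power_topology n) (\<lambda>k. (coordinatewise n (\<lambda>_. T) ^^ \<omega> k) (restrict x {..<n}))
        (coordinatewise n g (restrict x {..<n})) sequentially"
      by (subst limitin_power_topology) auto
    with x(1,2) have "restrict x {..<n} \<in> {y \<in> topspace (power_topology n).
          \<exists>\<omega>::nat \<Rightarrow> nat. strict_mono \<omega> \<and> (\<forall>k. 0 < \<omega> k) \<and>
          limitin (power_topology n) (\<lambda>k. (coordinatewise n (\<lambda>_. T) ^^ \<omega> k) y)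
            (coordinatewise n g y) sequentially}"
      unfolding mem_Collect_eq topspace_power_topology by (intro conjI exI [of _ \<omega>]) simp_all
    moreover have "restrict x {..<n} \<in> W"
      using xV V(3) by blast
    ultimately show "{y \<in> topspace (power_topology n).
          \<exists>\<omega>::nat \<Rightarrow> nat. strict_mono \<omega> \<and> (\<forall>k. 0 < \<omega> k) \<and>
          limitin (power_topology n) (\<lambda>k. (coordinatewise n (\<lambda>_. T) ^^ \<omega> k) y)
            (coordinatewise n g y) sequentially} \<inter> W \<noteq> {}"
      by (metis (no_types, lifting) IntI empty_iff)
  qed (use M in simp)
qed


section \<open>Approximation of a single operator\<close>

lemma graph_approximated_Omega:
  assumes "h \<in> Omega smul T"
  shows "graph_approximated T {h}"
  unfolding graph_approximated_def
proof (intro allI impI)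
  fix n K :: nat and g u A B
  assume *: "\<forall>i<n. g i \<in> {h} \<and> open (A i) \<and> u i \<in> A i \<and> open (B i) \<and> g i (u i) \<in> B i"
  obtain \<omega> :: "nat \<Rightarrow> nat" where \<omega>: "strict_mono \<omega>"
      and dense: "closure {x. (\<lambda>k. (T ^^ \<omega> k) x) \<longlonglongrightarrow> h x} = UNIV" and h: "h \<in> lin_ops smul"
    using assms by (auto simp: Omega_def)
  have "\<exists>x. x \<in> A i \<and> h x \<in> B i \<and> (\<lambda>k. (T ^^ \<omega> k) x) \<longlonglongrightarrow> h x" if "i < n" for i
  proof -
    have "open (A i \<inter> h -` B i)"
      using * that lin_ops_continuous [OF h] by (auto intro: open_vimage)
    moreover have "u i \<in> A i \<inter> h -` B i"
      using * that by auto
    ultimately show ?thesis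
      using open_Int_closure_eq_empty [of "A i \<inter> h -` B i"] dense by blast
  qed
  then obtain x where x: "\<And>i. i < n \<Longrightarrow> x i \<in> A i \<and> h (x i) \<in> B i \<and> (\<lambda>k. (T ^^ \<omega> k) (x i)) \<longlonglongrightarrow> h (x i)"
    by metis
  have "\<exists>m>K. \<forall>i<n. (T ^^ m) (x i) \<in> B i"
    by (rule convergent_orbits_enter [OF \<omega>, where l = "\<lambda>i. h (x i)"]) (use * x in simp_all)
  with x show "\<exists>m>K. \<forall>i<n. \<exists>x\<in>A i. (T ^^ m) x \<in> B i" by blast
qed

text \<open>In a separable space the sequence \<open>\<omega>\<close> can be chosen independently of the point: apply
  the common sequence to countably many open sets, shrinking to the points of a countable dense
  set.\<close>

lemma graph_approximated_imp_Omega: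
  assumes sep: "separable_space (euclidean :: 'a topology)" and T: "T \<in> lin_ops smul"
    and M: "M \<subseteq> lin_ops smul" "graph_approximated T M" and h: "h \<in> M"
  shows "h \<in> Omega smul T"
proof -
  obtain C :: "'a set" where C: "countable C" "closure C = UNIV"
    using sep by (auto simp: separable_space_def)
  then have "C \<noteq> {}" by auto
  obtain B :: "nat \<Rightarrow> 'a set" where B: "\<And>k. open (B k)" "\<And>k. 0 \<in> B k"
      "\<And>V. open V \<Longrightarrow> 0 \<in> V \<Longrightarrow> \<exists>k. \<forall>j\<ge>k. B j \<subseteq> V"
    using countable_nhds_zero by blast
  define c where "c j = from_nat_into C (fst (prod_decode j))" for j
  define U where "U j = (\<lambda>x. x - c j) -` B (snd (prod_decode j))" for j
  have open_U: "open (U j)" for j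
    unfolding U_def by (intro open_vimage B continuous_intros)
  have ne_U: "U j \<noteq> {}" for j
  proof -
    have "c j \<in> U j" using B(2) by (simp add: U_def)
    then show ?thesis by blast
  qed
  obtain x and \<omega> :: "nat \<Rightarrow> nat" where x: "strict_mono \<omega>" "\<And>k. 0 < \<omega> k" "\<And>i. x i \<in> U i"
      "\<And>i. (\<lambda>k. (T ^^ \<omega> k) (x i)) \<longlonglongrightarrow> h (x i)"
    by (rule graph_approximated_imp_common_sequence [OF T M, of "\<lambda>_. h" U, OF h open_U ne_U]) (rule that)
  have "a \<in> closure (range x)" if "a \<in> C" for a
  proof -
    obtain p where p: "from_nat_into C p = a"
      using C(1) \<open>a \<in> C\<close> from_nat_into_surj by metis
    define y where "y k = x (prod_encode (p, k))" for k
    have y: "y k - a \<in> B k" for k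
      using x(3) [of "prod_encode (p, k)"] by (simp add: y_def U_def c_def p)
    have "(\<lambda>k. y k - a) \<longlonglongrightarrow> 0"
    proof (rule topological_tendstoI)
      fix V :: "'a set" assume "open V" "0 \<in> V"
      then obtain j where "\<forall>l\<ge>j. B l \<subseteq> V"
        using B(3) by blast
      with y show "\<forall>\<^sub>F k in sequentially. y k - a \<in> V"
        unfolding eventually_sequentially by blast
    qed
    then have "(\<lambda>k. (y k - a) + a) \<longlonglongrightarrow> 0 + a"
      by (intro tendsto_add tendsto_const)
    then have y_lim: "y \<longlonglongrightarrow> a" by simp
    show ?thesis
      unfolding closure_iff_nhds_not_empty
    proof (intro allI impI)
      fix A V assume "V \<subseteq> A" "open V" "a \<in> V"
      then have "\<forall>\<^sub>F k in sequentially. y k \<in> V"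
        using y_lim topological_tendstoD by blast
      then obtain k where "y k \<in> V"
        using eventually_happens' [OF sequentially_bot] by blast
      then show "range x \<inter> A \<noteq> {}"
        using \<open>V \<subseteq> A\<close> unfolding y_def by blast
    qed
  qed
  then have "closure C \<subseteq> closure (range x)"
    by (meson closed_closure closure_minimal subsetI)
  moreover have "closure (range x) \<subseteq> closure {x. (\<lambda>k. (T ^^ \<omega> k) x) \<longlonglongrightarrow> h x}"
    using x(4) by (intro closure_mono) auto
  ultimately have "closure {x. (\<lambda>k. (T ^^ \<omega> k) x) \<longlonglongrightarrow> h x} = UNIV"
    using C(2) by blast
  moreover have "h \<in> lin_ops smul" using M(1) h by blast
  ultimately show ?thesis
    using x(1,2) by (auto simp: Omega_def)
qed


section \<open>Stability under composition and affine combinations\<close>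

lemma graph_approximated_compose:
  assumes T: "T \<in> lin_ops smul" and M: "graph_approximated T M"
    and N: "graph_approximated T N" "N \<subseteq> GL smul"
  shows "graph_approximated T {g \<circ> h | g h. g \<in> M \<and> h \<in> N}"
  unfolding graph_approximated_def
proof (intro allI impI)
  fix n K :: nat and f u A B
  assume *: "\<forall>i<n. f i \<in> {g \<circ> h | g h. g \<in> M \<and> h \<in> N} \<and> open (A i) \<and> u i \<in> A i \<and> open (B i) \<and> f i (u i) \<in> B i"
  have inverse: "\<exists>h'. h' \<in> lin_ops smul \<and> h \<circ> h' = id \<and> h' \<circ> h = id" if "h \<in> N" for h
    using subsetD [OF N(2) that] unfolding GL_def mem_Collect_eq Bex_def by (elim conjE)
  have "\<forall>i<n. \<exists>g h. f i = g \<circ> h \<and> g \<in> M \<and> h \<in> N"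
  proof (intro allI impI)
    fix i assume "i < n"
    then have "f i \<in> {g \<circ> h | g h. g \<in> M \<and> h \<in> N}"
      using * by simp
    then show "\<exists>g h. f i = g \<circ> h \<and> g \<in> M \<and> h \<in> N"
      unfolding mem_Collect_eq .
  qed
  then obtain g h where f: "\<And>i. i < n \<Longrightarrow> f i = g i \<circ> h i" and g: "\<And>i. i < n \<Longrightarrow> g i \<in> M"
    and h: "\<And>i. i < n \<Longrightarrow> h i \<in> N"
    unfolding choice_iff' by blast
  have "\<forall>i<n. \<exists>h'. h' \<in> lin_ops smul \<and> h i \<circ> h' = id \<and> h' \<circ> h i = id"
    using inverse h by simp
  then obtain h' where h': "\<And>i. i < n \<Longrightarrow> h' i \<in> lin_ops smul"
    and inv: "\<And>i. i < n \<Longrightarrow> h i \<circ> h' i = id" "\<And>i. i < n \<Longrightarrow> h' i \<circ> h i = id"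
    unfolding choice_iff' by blast
  have inv': "h i (h' i x) = x" "h' i (h i x) = x" if "i < n" for i x
    using inv [OF that] by (simp_all add: fun_eq_iff)
  \<comment> \<open>\<open>h' i -` A i\<close> is the image of \<open>A i\<close> under \<open>h i\<close>; it is open as \<open>h i\<close> is invertible.\<close>
  have "g i \<in> M \<and> open (h' i -` A i) \<and> h i (u i) \<in> h' i -` A i \<and> open (B i) \<and> g i (h i (u i)) \<in> B i"
    if "i \<in> {..<n}" for i
    using * f g that inv' lin_ops_continuous [OF h'] by (auto intro: open_vimage)
  then have "\<exists>m>K. \<exists>z. \<forall>i\<in>{..<n}. z i \<in> h' i -` A i \<and> (T ^^ m) (z i) \<in> B i"
    by (rule graph_approximatedD [OF M finite_lessThan])
  then obtain m z where m: "m > K" and z: "\<forall>i\<in>{..<n}. z i \<in> h' i -` A i \<and> (T ^^ m) (z i) \<in> B i"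
    by blast
  have "open ((T ^^ m) -` B i)" if "i < n" for i
    using * that lin_ops_continuous [OF lin_ops_funpow [OF T]] by (auto intro: open_vimage)
  then have "h i \<in> N \<and> open (A i) \<and> h' i (z i) \<in> A i \<and> open ((T ^^ m) -` B i) \<and>
      h i (h' i (z i)) \<in> (T ^^ m) -` B i" if "i \<in> {..<n}" for i
    using that h * z inv' by auto
  then have "\<exists>p>K. \<exists>w. \<forall>i\<in>{..<n}. w i \<in> A i \<and> (T ^^ p) (w i) \<in> (T ^^ m) -` B i"
    by (rule graph_approximatedD [OF N(1) finite_lessThan])
  then obtain p w where p: "p > K" and w: "\<forall>i\<in>{..<n}. w i \<in> A i \<and> (T ^^ p) (w i) \<in> (T ^^ m) -` B i"
    by blast
  from w have "\<forall>i<n. \<exists>x\<in>A i. (T ^^ (m + p)) x \<in> B i"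
    by (auto simp: funpow_add)
  with p show "\<exists>m>K. \<forall>i<n. \<exists>x\<in>A i. (T ^^ m) x \<in> B i"
    by (intro exI [of _ "m + p"]) auto
qed

lemma graph_approximated_Un:
  assumes "T \<in> lin_ops smul" "graph_approximated T M" "id \<in> M"
    and "graph_approximated T N" "N \<subseteq> GL smul" "id \<in> N"
  shows "graph_approximated T (M \<union> N)"
proof (rule graph_approximated_mono [OF graph_approximated_compose [OF assms(1,2,4,5)]])
  have "g \<circ> id \<in> {g \<circ> h | g h. g \<in> M \<and> h \<in> N}" if "g \<in> M" for g
    using that assms(6) by blast
  moreover have "id \<circ> h \<in> {g \<circ> h | g h. g \<in> M \<and> h \<in> N}" if "h \<in> N" for h
    using that assms(3) by blast
  ultimately show "M \<union> N \<subseteq> {g \<circ> h | g h. g \<in> M \<and> h \<in> N}"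
    by (simp only: comp_id id_comp) blast
qed

lemma linear_combination_nhds:
  assumes "finite I" "open A" "(\<Sum>i\<in>I. smul (\<alpha> i) (u i)) \<in> A"
  shows "\<exists>P. (\<forall>i\<in>I. open (P i) \<and> u i \<in> P i) \<and>
    (\<forall>x. (\<forall>i\<in>I. x i \<in> P i) \<longrightarrow> (\<Sum>i\<in>I. smul (\<alpha> i) (x i)) \<in> A)"
  using assms
proof (induction I arbitrary: A)
  case (insert a I)
  have "open ((\<lambda>p::'a \<times> 'a. fst p + snd p) -` A)"
    by (intro open_vimage insert.prems continuous_intros)
  moreover have "(smul (\<alpha> a) (u a), \<Sum>i\<in>I. smul (\<alpha> i) (u i)) \<in> (\<lambda>p::'a \<times> 'a. fst p + snd p) -` A"
    using insert by simp
  ultimately obtain C D where CD: "open C" "open D" "smul (\<alpha> a) (u a) \<in> C"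
      "(\<Sum>i\<in>I. smul (\<alpha> i) (u i)) \<in> D" "C \<times> D \<subseteq> (\<lambda>p::'a \<times> 'a. fst p + snd p) -` A"
    by (elim open_prod_elim) auto
  obtain P where P: "\<forall>i\<in>I. open (P i) \<and> u i \<in> P i"
      "\<forall>x. (\<forall>i\<in>I. x i \<in> P i) \<longrightarrow> (\<Sum>i\<in>I. smul (\<alpha> i) (x i)) \<in> D"
    using insert.IH [OF CD(2,4)] by blast
  have *: "c + d \<in> A" if "c \<in> C" "d \<in> D" for c d
    using CD(5) that by auto
  have "open (smul (\<alpha> a) -` C)"
    by (intro open_vimage CD continuous_intros)
  moreover have "(\<Sum>i\<in>insert a I. smul (\<alpha> i) (x i)) \<in> A"
    if "\<forall>i\<in>insert a I. x i \<in> (P(a := smul (\<alpha> a) -` C)) i" for x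
  proof -
    have "\<forall>i\<in>I. x i \<in> P i"
      using that insert.hyps(2) by (metis fun_upd_other insertI2)
    then show ?thesis
      using insert.hyps that P(2) * by simp
  qed
  ultimately show ?case
    using P(1) CD(3) insert.hyps(2) by (intro exI [of _ "P(a := smul (\<alpha> a) -` C)"]) auto
qed auto

text \<open>A point \<open>u\<close> equals \<open>\<Sum>i. \<alpha> i \<cdot> u\<close> when the coefficients add up to \<open>1\<close>. If \<open>x i\<close> is close to \<open>u\<close>
  and \<open>(T ^^ m) (x i)\<close> to \<open>h i u\<close> for every \<open>i\<close>, then \<open>\<Sum>i. \<alpha> i \<cdot> x i\<close> is close to \<open>u\<close>, and its image
  under \<open>T ^^ m\<close> to \<open>\<Sum>i. \<alpha> i \<cdot> h i u\<close>.\<close>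

lemma graph_approximated_affine_hull:
  assumes T: "T \<in> lin_ops smul" and M: "graph_approximated T M"
  shows "graph_approximated T (affine_hull_ops smul M)"
  unfolding graph_approximated_def
proof (intro allI impI)
  fix n K :: nat and f u A B
  assume *: "\<forall>j<n. f j \<in> affine_hull_ops smul M \<and> open (A j) \<and> u j \<in> A j \<and> open (B j) \<and> f j (u j) \<in> B j"
  then have "\<forall>j<n. \<exists>(m::nat) \<alpha> h. f j = (\<lambda>x. \<Sum>i=1..m. smul (\<alpha> i) (h i x)) \<and>
      (\<forall>i\<in>{1..m}. h i \<in> M) \<and> (\<Sum>i=1..m. \<alpha> i) = 1"
    unfolding affine_hull_ops_def by blast
  then obtain l :: "nat \<Rightarrow> nat" and \<alpha> h
    where f: "\<And>j. j < n \<Longrightarrow> f j = (\<lambda>x. \<Sum>i=1..l j. smul (\<alpha> j i) (h j i x))"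
      and h: "\<And>j i. j < n \<Longrightarrow> i \<in> {1..l j} \<Longrightarrow> h j i \<in> M"
      and \<alpha>: "\<And>j. j < n \<Longrightarrow> (\<Sum>i=1..l j. \<alpha> j i) = 1"
    unfolding choice_iff' by blast
  have "\<forall>j<n. \<exists>P. (\<forall>i\<in>{1..l j}. open (P i) \<and> u j \<in> P i) \<and>
      (\<forall>x. (\<forall>i\<in>{1..l j}. x i \<in> P i) \<longrightarrow> (\<Sum>i=1..l j. smul (\<alpha> j i) (x i)) \<in> A j)"
  proof (intro allI impI)
    fix j assume j: "j < n"
    have "(\<Sum>i=1..l j. smul (\<alpha> j i) (u j)) = u j"
      using \<alpha> [OF j] by (simp flip: scale_sum_left)
    then show "\<exists>P. (\<forall>i\<in>{1..l j}. open (P i) \<and> u j \<in> P i) \<and>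
        (\<forall>x. (\<forall>i\<in>{1..l j}. x i \<in> P i) \<longrightarrow> (\<Sum>i=1..l j. smul (\<alpha> j i) (x i)) \<in> A j)"
      using * j by (intro linear_combination_nhds) simp_all
  qed
  then obtain P where P: "\<And>j i. j < n \<Longrightarrow> i \<in> {1..l j} \<Longrightarrow> open (P j i) \<and> u j \<in> P j i"
    "\<And>j x. j < n \<Longrightarrow> (\<forall>i\<in>{1..l j}. x i \<in> P j i) \<Longrightarrow> (\<Sum>i=1..l j. smul (\<alpha> j i) (x i)) \<in> A j"
    unfolding choice_iff' by blast
  have "\<forall>j<n. \<exists>Q. (\<forall>i\<in>{1..l j}. open (Q i) \<and> h j i (u j) \<in> Q i) \<and>
      (\<forall>x. (\<forall>i\<in>{1..l j}. x i \<in> Q i) \<longrightarrow> (\<Sum>i=1..l j. smul (\<alpha> j i) (x i)) \<in> B j)"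
  proof (intro allI impI)
    fix j assume j: "j < n"
    have "(\<Sum>i=1..l j. smul (\<alpha> j i) (h j i (u j))) \<in> B j"
      using f * j by auto
    then show "\<exists>Q. (\<forall>i\<in>{1..l j}. open (Q i) \<and> h j i (u j) \<in> Q i) \<and>
        (\<forall>x. (\<forall>i\<in>{1..l j}. x i \<in> Q i) \<longrightarrow> (\<Sum>i=1..l j. smul (\<alpha> j i) (x i)) \<in> B j)"
      using * j by (intro linear_combination_nhds) simp_all
  qed
  then obtain Q where Q: "\<And>j i. j < n \<Longrightarrow> i \<in> {1..l j} \<Longrightarrow> open (Q j i) \<and> h j i (u j) \<in> Q j i"
    "\<And>j x. j < n \<Longrightarrow> (\<forall>i\<in>{1..l j}. x i \<in> Q j i) \<Longrightarrow> (\<Sum>i=1..l j. smul (\<alpha> j i) (x i)) \<in> B j"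
    unfolding choice_iff' by blast
  define I where "I = Sigma {..<n} (\<lambda>j. {1..l j})"
  have "finite I" by (simp add: I_def)
  have "case_prod h ji \<in> M \<and> open (case_prod P ji) \<and> u (fst ji) \<in> case_prod P ji \<and>
      open (case_prod Q ji) \<and> case_prod h ji (u (fst ji)) \<in> case_prod Q ji" if "ji \<in> I" for ji
    using that h P(1) Q(1) by (auto simp: I_def)
  then have "\<exists>m>K. \<exists>x. \<forall>ji\<in>I. x ji \<in> case_prod P ji \<and> (T ^^ m) (x ji) \<in> case_prod Q ji"
    by (rule graph_approximatedD [OF M \<open>finite I\<close>])
  then obtain m x where m: "m > K" and x: "\<forall>ji\<in>I. x ji \<in> case_prod P ji \<and> (T ^^ m) (x ji) \<in> case_prod Q ji"
    by blast
  have "\<exists>x\<in>A j. (T ^^ m) x \<in> B j" if "j < n" for j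
  proof -
    have "(\<Sum>i=1..l j. smul (\<alpha> j i) (x (j, i))) \<in> A j"
      using x that by (intro P(2)) (auto simp: I_def)
    moreover have "(\<Sum>i=1..l j. smul (\<alpha> j i) ((T ^^ m) (x (j, i)))) \<in> B j"
      using x that by (intro Q(2)) (auto simp: I_def)
    then have "(T ^^ m) (\<Sum>i=1..l j. smul (\<alpha> j i) (x (j, i))) \<in> B j"
      by (simp add: lin_ops_sum lin_ops_smul lin_ops_funpow [OF T])
    ultimately show ?thesis by (rule bexI [rotated])
  qed
  with m show "\<exists>m>K. \<forall>j<n. \<exists>x\<in>A j. (T ^^ m) x \<in> B j" by blast
qed

lemma affine_hull_ops_superset: "M \<subseteq> affine_hull_ops smul M"
proof
  fix g assume "g \<in> M"
  then show "g \<in> affine_hull_ops smul M"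
    unfolding affine_hull_ops_def
    by (intro CollectI exI [of _ 1] exI [of _ "\<lambda>_. 1"] exI [of _ "\<lambda>_. g"]) auto
qed

lemma affine_hull_ops_mono: "M \<subseteq> M' \<Longrightarrow> affine_hull_ops smul M \<subseteq> affine_hull_ops smul M'"
  unfolding affine_hull_ops_def by blast

lemma affine_hull_ops_binary:
  assumes "g \<in> M" "h \<in> M"
  shows "(\<lambda>x. smul (1 - t) (g x) + smul t (h x)) \<in> affine_hull_ops smul M"
proof -
  have "{1..2::nat} = {1, 2}" by auto
  then show ?thesis
    using assms unfolding affine_hull_ops_def
    by (intro CollectI exI [of _ 2] exI [of _ "\<lambda>i. if i = 1 then 1 - t else t"]
        exI [of _ "\<lambda>i. if i = 1 then g else h"]) auto
qed


section \<open>Maximal collections and their invertible members\<close>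

context
  fixes T :: "'a \<Rightarrow> 'a"
  assumes T: "T \<in> lin_ops smul"
begin

lemma maximal_iff:
  "maximal_approximated_with_id smul T N \<longleftrightarrow>
     ((N \<subseteq> lin_ops smul \<and> graph_approximated T N) \<and>
      (\<forall>M. (M \<subseteq> lin_ops smul \<and> graph_approximated T M) \<and> N \<subseteq> M \<longrightarrow> M = N)) \<and> id \<in> N"
  unfolding maximal_approximated_with_id_def maximal_with_def simultaneously_approximated_iff [OF T]
  by (rule refl)

lemma maximalD:
  assumes "maximal_approximated_with_id smul T N"
  shows "N \<subseteq> lin_ops smul" "graph_approximated T N" "id \<in> N"
    and "M \<subseteq> lin_ops smul \<Longrightarrow> graph_approximated T M \<Longrightarrow> N \<subseteq> M \<Longrightarrow> M = N"
proof -
  note N = assms [unfolded maximal_iff]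
  show "N \<subseteq> lin_ops smul" "graph_approximated T N" "id \<in> N"
    by (rule N [THEN conjunct1, THEN conjunct1, THEN conjunct1]
        N [THEN conjunct1, THEN conjunct1, THEN conjunct2] N [THEN conjunct2])+
  show "M = N" if "M \<subseteq> lin_ops smul" "graph_approximated T M" "N \<subseteq> M"
    by (rule N [THEN conjunct1, THEN conjunct2, rule_format]) (intro conjI that)
qed

lemma maximal_affine_hull:
  assumes "maximal_approximated_with_id smul T N"
  shows "affine_hull_ops smul N = N"
proof (rule maximalD(4) [OF assms])
  have "(\<lambda>x. \<Sum>i=1..m. smul (\<alpha> i) (h i x)) \<in> lin_ops smul" if "\<forall>i\<in>{1..m}. h i \<in> N" for m :: nat and \<alpha> h
    using that maximalD(1) [OF assms] by (intro lin_ops_linear_combination) auto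
  then show "affine_hull_ops smul N \<subseteq> lin_ops smul"
    unfolding affine_hull_ops_def by (intro subsetI) (elim CollectE exE conjE, simp)
  show "graph_approximated T (affine_hull_ops smul N)"
    by (rule graph_approximated_affine_hull [OF T maximalD(2) [OF assms]])
qed (rule affine_hull_ops_superset)

lemma maximal_contains_invertible_collections:
  assumes N: "maximal_approximated_with_id smul T N"
    and M: "graph_approximated T M" "M \<subseteq> GL smul" "id \<in> M"
  shows "M \<subseteq> N"
proof -
  have "N \<union> M = N"
  proof (rule maximalD(4) [OF N])
    show "N \<union> M \<subseteq> lin_ops smul"
      using maximalD(1) [OF N] M(2) GL_subset by (meson Un_least subset_trans)
    show "graph_approximated T (N \<union> M)"
      by (rule graph_approximated_Un [OF T maximalD(2,3) [OF N] M])
  qed simp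
  then show ?thesis by blast
qed

text \<open>The invertible members of \<open>N\<close> form the greatest, not only a maximal, approximated collection
  of invertible operators that contains the identity. Membership in \<^const>\<open>Omega\<close> is automatic.\<close>

lemma G_group_eq:
  assumes sep: "separable_space (euclidean :: 'a topology)"
    and N: "maximal_approximated_with_id smul T N"
  shows "G_group smul T = N \<inter> GL smul"
proof -
  define P where "P M \<longleftrightarrow> simultaneously_approximated smul T M \<and> M \<subseteq> Omega smul T \<inter> GL smul" for M
  have P_iff: "P M \<longleftrightarrow> graph_approximated T M \<and> M \<subseteq> GL smul" for M
    using graph_approximated_imp_Omega [OF sep T] GL_subset
    unfolding P_def simultaneously_approximated_iff [OF T] by blast
  have PG: "P (N \<inter> GL smul)"
    using N graph_approximated_mono [of T N "N \<inter> GL smul"] unfolding P_iff maximal_iff by auto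
  have id: "id \<in> N \<inter> GL smul"
    using N GL_id by (simp add: maximal_iff)
  have great: "M \<subseteq> N \<inter> GL smul" if "P M" "id \<in> M" for M
    using that maximal_contains_invertible_collections [OF N] by (simp add: P_iff)
  have "(THE G. maximal_with P G \<and> id \<in> G) = N \<inter> GL smul"
  proof (rule the_equality)
    show "maximal_with P (N \<inter> GL smul) \<and> id \<in> N \<inter> GL smul"
      using PG id great unfolding maximal_with_def by blast
    show "G = N \<inter> GL smul" if "maximal_with P G \<and> id \<in> G" for G
      using that PG great unfolding maximal_with_def by blast
  qed
  then show ?thesis
    unfolding G_group_def P_def .
qed

lemma maximal_exists:
  assumes "quasi_rigid smul T"
  obtains N where "maximal_approximated_with_id smul T N"
proof -
  define \<A> where "\<A> = {M. (M \<subseteq> lin_ops smul \<and> graph_approximated T M) \<and> id \<in> M}"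
  have A_iff: "M \<in> \<A> \<longleftrightarrow> (M \<subseteq> lin_ops smul \<and> graph_approximated T M) \<and> id \<in> M" for M
    unfolding \<A>_def by (rule mem_Collect_eq)
  have "graph_approximated T {id}"
    using assms unfolding quasi_rigid_def by (rule graph_approximated_Omega)
  then have "{id} \<in> \<A>"
    unfolding A_iff using lin_ops_id by simp
  then have "\<A> \<noteq> {}" by blast
  then have "\<exists>N\<in>\<A>. \<forall>M\<in>\<A>. N \<subseteq> M \<longrightarrow> M = N"
  proof (rule subset_Zorn_nonempty)
    fix \<C> assume C: "\<C> \<noteq> {}" "subset.chain \<A> \<C>"
    then have C_A: "M \<in> \<A>" if "M \<in> \<C>" for M
      using that by (meson subset.chain_def subsetD)
    have "graph_approximated T (\<Union>\<C>)"
      by (rule graph_approximated_Union_chain [OF C(2,1)]) (drule C_A, simp add: A_iff)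
    moreover have "\<Union>\<C> \<subseteq> lin_ops smul"
      using C_A unfolding A_iff by (simp add: Sup_le_iff)
    moreover have "id \<in> \<Union>\<C>"
      using C_A C(1) unfolding A_iff by (metis UnionI ex_in_conv)
    ultimately show "\<Union>\<C> \<in> \<A>"
      unfolding A_iff by (intro conjI)
  qed
  then obtain N where N: "N \<in> \<A>" "\<And>M. M \<in> \<A> \<Longrightarrow> N \<subseteq> M \<Longrightarrow> M = N"
    by meson
  have "maximal_approximated_with_id smul T N"
    unfolding maximal_iff
  proof (intro conjI allI impI)
    show "N \<subseteq> lin_ops smul" "graph_approximated T N" "id \<in> N"
      using N(1) by (simp_all add: A_iff)
    fix M assume M: "(M \<subseteq> lin_ops smul \<and> graph_approximated T M) \<and> N \<subseteq> M"
    show "M = N"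
    proof (rule N(2))
      show "M \<in> \<A>"
        using M \<open>id \<in> N\<close> unfolding A_iff by (simp add: subset_iff)
    qed (use M in simp)
  qed
  then show thesis by (rule that)
qed

end


section \<open>Invertible operators on a Banach space\<close>

context
  fixes nrm :: "'a \<Rightarrow> real"
  assumes nrm: "banach_norm smul nrm"
begin

lemma nrm_nonneg: "0 \<le> nrm x"
  and nrm_eq_0: "nrm x = 0 \<longleftrightarrow> x = 0"
  and nrm_triangle: "nrm (x + y) \<le> nrm x + nrm y"
  and nrm_smul: "nrm (smul c x) = norm c * nrm x"
  using nrm by (auto simp: banach_norm_def)

lemma nrm_minus: "nrm (- x) = nrm x"
  using nrm_smul [of "-1" x] by simp

lemma nrm_minus_commute: "nrm (x - y) = nrm (y - x)"
  using nrm_minus [of "x - y"] by simp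

lemma nrm_diff_triangle: "nrm (x - z) \<le> nrm (x - y) + nrm (y - z)"
  using nrm_triangle [of "x - y" "y - z"] by simp

interpretation B: Metric_space UNIV "\<lambda>x y. nrm (x - y)"
  by unfold_locales (auto simp: nrm_nonneg nrm_eq_0 nrm_minus_commute nrm_diff_triangle)

lemma open_iff_nrm: "open U \<longleftrightarrow> (\<forall>x\<in>U. \<exists>r>0. \<forall>y. nrm (x - y) < r \<longrightarrow> y \<in> U)"
proof -
  have "open U \<longleftrightarrow> openin B.mtopology U"
    using nrm by (simp add: banach_norm_def)
  also have "\<dots> \<longleftrightarrow> (\<forall>x\<in>U. \<exists>r>0. \<forall>y. nrm (x - y) < r \<longrightarrow> y \<in> U)"
    by (auto simp: B.openin_mtopology subset_iff)
  finally show ?thesis .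
qed

lemma lin_ops_bounded:
  assumes h: "h \<in> lin_ops smul"
  obtains C where "C > 0" "\<And>x. nrm (h x) \<le> C * nrm x"
proof -
  have "open {x. nrm x < 1}"
    unfolding open_iff_nrm
  proof (intro ballI)
    fix x assume x: "x \<in> {x. nrm x < 1}"
    have "nrm y < 1" if "nrm (x - y) < 1 - nrm x" for y
      using nrm_triangle [of "y - x" x] that nrm_minus_commute [of x y] by simp
    with x show "\<exists>r>0. \<forall>y. nrm (x - y) < r \<longrightarrow> y \<in> {x. nrm x < 1}"
      by (intro exI [of _ "1 - nrm x"]) auto
  qed
  then have "open (h -` {x. nrm x < 1})"
    by (intro open_vimage lin_ops_continuous h)
  moreover have "0 \<in> h -` {x. nrm x < 1}"
    using lin_ops_zero [OF h] nrm_eq_0 [of 0] by simp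
  ultimately obtain r where r: "r > 0" "\<And>y. nrm (0 - y) < r \<Longrightarrow> nrm (h y) < 1"
    unfolding open_iff_nrm by blast
  show thesis
  proof
    show "2 / r > 0" using r(1) by simp
    show "nrm (h x) \<le> (2 / r) * nrm x" for x
    proof (cases "x = 0")
      case True
      then show ?thesis using lin_ops_zero [OF h] nrm_eq_0 [of 0] by simp
    next
      case False
      then have pos: "nrm x > 0"
        using nrm_nonneg [of x] nrm_eq_0 [of x] by linarith
      define c :: 'k where "c = of_real (r / (2 * nrm x))"
      have nc: "norm c = r / (2 * nrm x)"
        unfolding c_def norm_of_real using pos r(1) by simp
      have "nrm (smul c x) < r"
        unfolding nrm_smul nc using pos r(1) by simp
      then have "nrm (h (smul c x)) < 1"
        using r(2) [of "smul c x"] nrm_minus [of "smul c x"] by simp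
      then have "r / (2 * nrm x) * nrm (h x) < 1"
        by (simp add: lin_ops_smul [OF h] nrm_smul nc)
      then show ?thesis
        using pos r(1) by (simp add: field_simps)
    qed
  qed
qed

lemma lin_opsI_bounded:
  assumes add: "\<And>x y. h (x + y) = h x + h y" and smul: "\<And>c x. h (smul c x) = smul c (h x)"
    and bound: "\<And>x. nrm (h x) \<le> C * nrm x"
  shows "h \<in> lin_ops smul"
proof -
  define D where "D = max C 1"
  have D: "D > 0" "nrm (h x) \<le> D * nrm x" for x
    using bound [of x] mult_right_mono [of C D "nrm x"] nrm_nonneg [of x] by (auto simp: D_def)
  have diff: "h x - h y = h (x - y)" for x y
    by (metis add add_diff_cancel_right' diff_add_cancel)
  have "open (h -` U)" if U: "open U" for U
    unfolding open_iff_nrm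
  proof (intro ballI)
    fix x assume "x \<in> h -` U"
    then obtain r where r: "r > 0" "\<And>z. nrm (h x - z) < r \<Longrightarrow> z \<in> U"
      using U unfolding open_iff_nrm by auto
    have "h y \<in> U" if "nrm (x - y) < r / D" for y
    proof (rule r(2))
      have "nrm (h x - h y) \<le> D * nrm (x - y)"
        unfolding diff by (rule D)
      also have "\<dots> < r"
        using that D(1) by (simp add: field_simps)
      finally show "nrm (h x - h y) < r" .
    qed
    with r(1) D(1) show "\<exists>r>0. \<forall>y. nrm (x - y) < r \<longrightarrow> y \<in> h -` U"
      by (intro exI [of _ "r / D"]) auto
  qed
  then show ?thesis
    using add smul by (simp add: lin_ops_iff continuous_on_open_vimage)
qed

text \<open>A perturbation of the identity by a contraction is invertible: the equation \<open>x - L x = y\<close> is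
  solved by the fixed point of the contraction \<open>x \<mapsto> y + L x\<close>.\<close>

lemma GL_id_minus_contraction:
  assumes L: "L \<in> lin_ops smul" and q: "q < 1" and bound: "\<And>x. nrm (L x) \<le> q * nrm x"
  shows "(\<lambda>x. x - L x) \<in> GL smul"
proof -
  let ?S = "\<lambda>x. x - L x"
  have S: "?S \<in> lin_ops smul"
    using lin_ops_minus_op [OF lin_ops_id L] by simp
  have below: "(1 - q) * nrm x \<le> nrm (?S x)" for x
    using nrm_triangle [of "?S x" "L x"] bound [of x] by (simp add: algebra_simps)
  have ex: "\<exists>x. ?S x = y" for y
  proof -
    have "nrm ((y + L a) - (y + L b)) \<le> q * nrm (a - b)" for a b
      using bound [of "a - b"] by (simp add: lin_ops_diff [OF L])
    moreover have "B.mcomplete"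
      using nrm by (simp add: banach_norm_def)
    ultimately obtain x where "y + L x = x"
      using B.Banach_fixedpoint_thm [of "\<lambda>x. y + L x" q] q by auto
    then show ?thesis
      by (metis add_diff_cancel_right')
  qed
  have inj: "x = z" if "?S x = ?S z" for x z
  proof -
    have "(1 - q) * nrm (x - z) \<le> nrm (?S (x - z))"
      by (rule below)
    also have "?S (x - z) = 0"
      using that by (simp add: lin_ops_diff [OF L] algebra_simps)
    finally have "(1 - q) * nrm (x - z) \<le> 0"
      using nrm_eq_0 [of 0] by simp
    then have "nrm (x - z) \<le> 0"
      using q by (simp add: mult_le_0_iff)
    then show ?thesis
      using nrm_nonneg [of "x - z"] nrm_eq_0 [of "x - z"] by simp
  qed
  obtain R where R: "\<And>y. ?S (R y) = y"
    using ex by metis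
  have RS: "R (?S x) = x" for x
    using inj R by blast
  have "R \<in> lin_ops smul"
  proof (rule lin_opsI_bounded)
    show "R (x + y) = R x + R y" for x y
      by (rule inj) (metis R S lin_ops_add)
    show "R (smul c x) = smul c (R x)" for c x
      by (rule inj) (metis R S lin_ops_smul)
    show "nrm (R x) \<le> (1 / (1 - q)) * nrm x" for x
      using below [of "R x"] q by (simp add: R field_simps)
  qed
  moreover have "?S \<circ> R = id" "R \<circ> ?S = id"
    using R RS by auto
  ultimately show ?thesis
    using S unfolding GL_def by blast
qed

lemma op_norm_upper:
  assumes "h \<in> lin_ops smul"
  shows "nrm (h x) / nrm x \<le> op_norm nrm h"
proof -
  obtain C where C: "C > 0" "\<And>x. nrm (h x) \<le> C * nrm x"
    using lin_ops_bounded [OF assms] by blast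
  have "nrm (h x) / nrm x \<le> C" for x
    using C nrm_nonneg [of x] by (cases "nrm x = 0") (auto simp: field_simps)
  then have "bdd_above (range (\<lambda>x. nrm (h x) / nrm x))"
    by (auto simp: bdd_above_def)
  then show ?thesis
    unfolding op_norm_def by (rule cSUP_upper2 [of _ _ x]) auto
qed

lemma op_norm_nonneg:
  assumes "h \<in> lin_ops smul" shows "0 \<le> op_norm nrm h"
  using op_norm_upper [OF assms, of 0] nrm_eq_0 [of 0] by simp

lemma op_norm_bound:
  assumes "h \<in> lin_ops smul"
  shows "nrm (h x) \<le> op_norm nrm h * nrm x"
proof (cases "x = 0")
  case True
  then show ?thesis
    using lin_ops_zero [OF assms] nrm_eq_0 [of 0] by simp
next
  case False
  then have "nrm x > 0"
    using nrm_nonneg [of x] nrm_eq_0 [of x] by linarith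
  then show ?thesis
    using op_norm_upper [OF assms, of x] by (simp add: field_simps)
qed

lemma op_norm_le:
  assumes "0 \<le> C" "\<And>x. nrm (h x) \<le> C * nrm x"
  shows "op_norm nrm h \<le> C"
  unfolding op_norm_def
proof (rule cSUP_least)
  show "nrm (h x) / nrm x \<le> C" for x
    using assms(1) assms(2) [of x] nrm_nonneg [of x] by (cases "nrm x = 0") (auto simp: field_simps)
qed simp

lemma GL_open:
  assumes g: "g \<in> GL smul"
  obtains r where "r > 0" "op_ball smul nrm g r \<subseteq> GL smul"
proof -
  obtain k where k: "k \<in> lin_ops smul" "g \<circ> k = id" "k \<circ> g = id" and gl: "g \<in> lin_ops smul"
    using g by (auto simp: GL_def)
  obtain C where C: "C > 0" "\<And>x. nrm (k x) \<le> C * nrm x"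
    using lin_ops_bounded [OF k(1)] by blast
  have "h \<in> GL smul" if h: "h \<in> lin_ops smul" "op_norm nrm (\<lambda>x. h x - g x) < 1 / C" for h
  proof -
    \<comment> \<open>\<open>h = g \<circ> (id - g\<inverse> \<circ> (g - h))\<close>\<close>
    let ?L = "k \<circ> (\<lambda>x. g x - h x)" and ?d = "\<lambda>x. h x - g x"
    have d: "?d \<in> lin_ops smul"
      using h gl by (intro lin_ops_minus_op)
    have "?L \<in> lin_ops smul"
      using h k gl by (intro lin_ops_compose lin_ops_minus_op)
    moreover have "C * op_norm nrm ?d < 1"
      using h(2) C(1) by (simp add: field_simps)
    moreover have "nrm (?L x) \<le> (C * op_norm nrm ?d) * nrm x" for x
    proof -
      have "nrm (?L x) \<le> C * nrm (g x - h x)"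
        using C(2) by simp
      also have "\<dots> \<le> C * (op_norm nrm ?d * nrm x)"
        using op_norm_bound [OF d, of x] C(1) nrm_minus_commute [of "g x" "h x"]
        by (intro mult_left_mono) auto
      finally show ?thesis by (simp add: mult.assoc)
    qed
    ultimately have "(\<lambda>x. x - ?L x) \<in> GL smul"
      by (rule GL_id_minus_contraction)
    moreover have "g \<circ> (\<lambda>x. x - ?L x) = h"
    proof
      have "g (k x) = x" for x
        using k(2) by (metis comp_apply id_apply)
      then show "(g \<circ> (\<lambda>x. x - ?L x)) x = h x" for x
        by (simp add: lin_ops_diff [OF gl])
    qed
    ultimately show ?thesis
      using GL_compose [OF g] by metis
  qed
  then show thesis
    using that [of "1 / C"] C(1) by (auto simp: op_ball_def)
qed

lemma convex_ops_op_ball: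
  assumes g: "g \<in> lin_ops smul"
  shows "convex_ops smul (op_ball smul nrm g r)"
  unfolding convex_ops_def
proof (intro ballI allI impI)
  fix h1 h2 and t :: real
  assume h: "h1 \<in> op_ball smul nrm g r" "h2 \<in> op_ball smul nrm g r" and t: "0 \<le> t \<and> t \<le> 1"
  let ?h = "\<lambda>x. smul (of_real (1 - t)) (h1 x) + smul (of_real t) (h2 x)"
  let ?d1 = "\<lambda>x. h1 x - g x" and ?d2 = "\<lambda>x. h2 x - g x"
  have lin: "h1 \<in> lin_ops smul" "h2 \<in> lin_ops smul"
    and lt: "op_norm nrm ?d1 < r" "op_norm nrm ?d2 < r"
    using h by (auto simp: op_ball_def)
  have d: "?d1 \<in> lin_ops smul" "?d2 \<in> lin_ops smul"
    using lin g by (auto intro: lin_ops_minus_op)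
  define c where "c = max (op_norm nrm ?d1) (op_norm nrm ?d2)"
  have c: "0 \<le> c" "c < r"
    using lt op_norm_nonneg [OF d(1)] by (auto simp: c_def)
  have b: "nrm (?d1 x) \<le> c * nrm x" "nrm (?d2 x) \<le> c * nrm x" for x
    using op_norm_bound [OF d(1), of x] op_norm_bound [OF d(2), of x] nrm_nonneg [of x]
      mult_right_mono [of _ c "nrm x"] unfolding c_def by (meson max.cobounded1 max.cobounded2 order_trans)+
  have bound: "nrm (?h x - g x) \<le> c * nrm x" for x
  proof -
    have "g x = smul (of_real (1 - t) + of_real t) (g x)"
      by simp
    then have "?h x - g x = smul (of_real (1 - t)) (?d1 x) + smul (of_real t) (?d2 x)"
      by (metis (no_types, lifting) add_diff_add scale_left_distrib scale_right_diff_distrib)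
    also have "nrm \<dots> \<le> (1 - t) * nrm (?d1 x) + t * nrm (?d2 x)"
      using nrm_triangle [of "smul (of_real (1 - t)) (?d1 x)" "smul (of_real t) (?d2 x)"] t
      by (simp only: nrm_smul norm_of_real) simp
    also have "\<dots> \<le> (1 - t) * (c * nrm x) + t * (c * nrm x)"
      using t b by (intro add_mono mult_left_mono) auto
    also have "\<dots> = c * nrm x" by (simp add: algebra_simps)
    finally show ?thesis .
  qed
  have "op_norm nrm (\<lambda>x. ?h x - g x) < r"
    using op_norm_le [OF c(1) bound] c(2) by (rule le_less_trans)
  moreover have "?h \<in> lin_ops smul"
    using lin by (auto simp: lin_ops_iff scale_right_distrib mult.commute intro!: continuous_intros)
  ultimately show "?h \<in> op_ball smul nrm g r"
    by (simp add: op_ball_def)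
qed

text \<open>Near one of its members, the invertible part of \<open>N\<close> coincides with the affine manifold \<open>N\<close>.\<close>

lemma locally_convex_invertible_part:
  assumes "N \<subseteq> lin_ops smul" "affine_hull_ops smul N = N"
  shows "locally_convex_ops smul nrm (N \<inter> GL smul)"
  unfolding locally_convex_ops_def
proof (intro ballI)
  fix g assume g: "g \<in> N \<inter> GL smul"
  then obtain r where r: "r > 0" "op_ball smul nrm g r \<subseteq> GL smul"
    using GL_open by blast
  have eq: "N \<inter> GL smul \<inter> op_ball smul nrm g r = N \<inter> op_ball smul nrm g r"
    using r(2) by blast
  have "convex_ops smul N"
    unfolding convex_ops_def using affine_hull_ops_binary [of _ N] assms(2) by simp
  moreover have "convex_ops smul (op_ball smul nrm g r)"
    using g assms(1) by (intro convex_ops_op_ball) blast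
  ultimately have "convex_ops smul (N \<inter> op_ball smul nrm g r)"
    by (simp add: convex_ops_def)
  with r(1) eq show "\<exists>r>0. convex_ops smul (N \<inter> GL smul \<inter> op_ball smul nrm g r)"
    by metis
qed

text \<open>For \<open>h \<in> N\<close> and small \<open>t \<noteq> 0\<close> the operator \<open>(1 - t) id + t h\<close> is invertible, and \<open>h\<close> lies on the line
  through it and the identity.\<close>

lemma affine_hull_invertible_part:
  assumes N: "N \<subseteq> lin_ops smul" "affine_hull_ops smul N = N" and id: "id \<in> N"
  shows "affine_hull_ops smul (N \<inter> GL smul) = N"
proof
  show "affine_hull_ops smul (N \<inter> GL smul) \<subseteq> N"
    using affine_hull_ops_mono [of "N \<inter> GL smul" N] N(2) by auto
  show "N \<subseteq> affine_hull_ops smul (N \<inter> GL smul)"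
  proof
    fix h assume h: "h \<in> N"
    then have hl: "h \<in> lin_ops smul" using N(1) by blast
    have D: "(\<lambda>x. x - h x) \<in> lin_ops smul"
      using lin_ops_minus_op [OF lin_ops_id hl] by simp
    then obtain C where C: "C > 0" "\<And>x. nrm (x - h x) \<le> C * nrm x"
      using lin_ops_bounded by blast
    define t :: 'k where "t = of_real (1 / (2 * C))"
    have t: "t \<noteq> 0" "norm t = 1 / (2 * C)"
      unfolding t_def norm_of_real using C(1) by simp_all
    define f where "f x = smul (1 - t) (id x) + smul t (h x)" for x
    have "f \<in> N"
      using affine_hull_ops_binary [OF id h, of t] N(2) by (simp add: f_def [abs_def])
    moreover have "f \<in> GL smul"
    proof -
      have "(\<lambda>x. smul t (x - h x)) \<in> lin_ops smul"
        using lin_ops_linear_combination [of "{0::nat}" "\<lambda>_ x. x - h x" "\<lambda>_. t"] D by simp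
      moreover have "nrm (smul t (x - h x)) \<le> 1 / 2 * nrm x" for x
      proof -
        have "1 / (2 * C) * nrm (x - h x) \<le> 1 / (2 * C) * (C * nrm x)"
          using C by (intro mult_left_mono) auto
        then show ?thesis
          unfolding nrm_smul t(2) using C(1) by simp
      qed
      ultimately have "(\<lambda>x. x - smul t (x - h x)) \<in> GL smul"
        by (intro GL_id_minus_contraction [of _ "1 / 2"]) auto
      moreover have "(\<lambda>x. x - smul t (x - h x)) = f"
        by (simp add: f_def fun_eq_iff algebra_simps)
      ultimately show ?thesis by simp
    qed
    ultimately have "(\<lambda>x. smul (1 - inverse t) (id x) + smul (inverse t) (f x))
        \<in> affine_hull_ops smul (N \<inter> GL smul)"
      using id GL_id by (intro affine_hull_ops_binary IntI)
    moreover have "(\<lambda>x. smul (1 - inverse t) (id x) + smul (inverse t) (f x)) = h"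
      using t(1) by (simp add: f_def fun_eq_iff algebra_simps)
    ultimately show "h \<in> affine_hull_ops smul (N \<inter> GL smul)"
      by metis
  qed
qed

end

end


section \<open>The affine structure of maximal collections\<close>

theorem theorem3p19:
  fixes smul :: "'k::real_or_complex \<Rightarrow> 'a::topological_ab_group_add \<Rightarrow> 'a"
    and T :: "'a \<Rightarrow> 'a"
  assumes "F_space smul"
    and "separable_space (euclidean :: 'a topology)"
    and "infinite_dimensional smul"
    and "T \<in> lin_ops smul"
    and "quasi_rigid smul T"
  shows "(\<forall>N. maximal_approximated_with_id smul T N \<longrightarrow>
            G_group smul T = N \<inter> GL smul \<and>
            affine_hull_ops smul (G_group smul T) \<subseteq> N) \<and>
         (\<forall>nrm. banach_norm smul nrm \<longrightarrow>
            locally_convex_ops smul nrm (G_group smul T) \<and>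
            affine_manifold_ops smul (affine_hull_ops smul (G_group smul T)) \<and>
            maximal_approximated_with_id smul T (affine_hull_ops smul (G_group smul T)) \<and>
            (\<forall>M. maximal_approximated_with_id smul T M \<longrightarrow>
               M = affine_hull_ops smul (G_group smul T)))"
proof -
  interpret F_space smul by fact
  note T = \<open>T \<in> lin_ops smul\<close>
  have G: "G_group smul T = N \<inter> GL smul" if "maximal_approximated_with_id smul T N" for N
    using G_group_eq [OF T \<open>separable_space euclidean\<close> that] .
  show ?thesis
  proof (intro conjI allI impI)
    fix N assume N: "maximal_approximated_with_id smul T N"
    then show "G_group smul T = N \<inter> GL smul" by (rule G)
    then show "affine_hull_ops smul (G_group smul T) \<subseteq> N"
      using affine_hull_ops_mono [of "N \<inter> GL smul" N] maximal_affine_hull [OF T N] by auto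
  next
    fix nrm assume nrm: "banach_norm smul nrm"
    have hull: "affine_hull_ops smul (G_group smul T) = N"
      if "maximal_approximated_with_id smul T N" for N
      using affine_hull_invertible_part [OF nrm _ maximal_affine_hull [OF T that]] that
      by (simp add: G [OF that] maximal_iff [OF T])
    obtain N where N: "maximal_approximated_with_id smul T N"
      using maximal_exists [OF T \<open>quasi_rigid smul T\<close>] by blast
    show "locally_convex_ops smul nrm (G_group smul T)"
      using locally_convex_invertible_part [OF nrm _ maximal_affine_hull [OF T N]] N
      by (simp add: G [OF N] maximal_iff [OF T])
    show "affine_manifold_ops smul (affine_hull_ops smul (G_group smul T))"
      unfolding hull [OF N] affine_manifold_ops_def
      using affine_hull_ops_binary [of _ N] maximal_affine_hull [OF T N] by simp
    show "maximal_approximated_with_id smul T (affine_hull_ops smul (G_group smul T))"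
      using N hull [OF N] by simp
    show "M = affine_hull_ops smul (G_group smul T)" if "maximal_approximated_with_id smul T M" for M
      using hull [OF that] by simp
  qed
qed

end
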